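(* In the setting of the context, assume that $(\gamma_n)_{n\ge0}$ and $(\eta_n)_{n\ge1}$ satisfy the step-weight assumption (SW), and that there exists an almost surely finite random variable $n_1$ such that $\tilde\gamma_n=\gamma_n$ for every $n\ge n_1$. Suppose that $W:\mathbb{R}^d\to(0,+\infty)$ is a function for which there exist $\alpha>0$, $\beta>0$, $n_0\in\mathbb{N}$ such that $$\forall n\ge n_0,\quad\frac{\mathbb{E}\bigl[W(X_{n+1})\,|\,\mathcal{F}_n\bigr]-W(X_n)}{\tilde\gamma_{n+1}}\le-\alpha W(X_n)+\beta,$$ and that $$\sum_{n\ge1}\Bigl(\frac{\eta_n}{H_n\gamma_n}\Bigr)^s\,\mathbb{E}\Bigl[\bigl|W(X_n)-\mathbb{E}[W(X_n)\,|\,\mathcal{F}_{n-1}]\bigr|^s\,\Big|\,\mathcal{F}_{n-1}\Bigr]<+\infty\quad\text{a.s.}$$ for some $s\in(1,2]$. Then $$\sup_{n\ge1}\nu_n^\eta(W)<+\infty\quad\text{a.s.}$$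
   Context: **Noise.** $(U_n)_{n\ge1}$ are i.i.d. $\mathbb{R}^m$-valued random variables with $\mathrm{var}(U_1)=\mathrm{Id}_m$ and, for some $\kappa>0$, $\mathbb{E}[\exp\langle\theta,U_1\rangle]\le\exp(\kappa|\theta|^2/2)$ for all $\theta\in\mathbb{R}^m$. $\mathcal{F}_n=\sigma(U_1,\dots,U_n)$, $\mathcal{F}_0$ trivial. **Scheme.** $b:\mathbb{R}^d\to\mathbb{R}^d$ and $\sigma:\mathbb{R}^d\to\mathbb{R}^{d\times m}$ are locally Lipschitz. $(\gamma_n)_{n\ge0}$ is a deterministic nonincreasing sequence of positive numbers with $\lim_n\gamma_n=0$ and $\sum_n\gamma_n=+\infty$; $(\chi_n)_{n\ge0}$ is an $(\mathcal{F}_n)$-adapted sequence of positive random variables; $\tilde\gamma_0=\gamma_0$ and $\tilde\gamma_n=\gamma_n\wedge\chi_{n-1}$ for $n\ge1$. From a deterministic $X_0=x_0\in\mathbb{R}^d$, $$X_{n+1}=X_n+\tilde\gamma_{n+1}b(X_n)+\sqrt{\tilde\gamma_{n+1}}\,\sigma(X_n)U_{n+1},\quad n\ge0.$$ **Standing assumption.** There is a $C^2$ function $V:\mathbb{R}^d\to[1,+\infty)$ with $V(x)\to+\infty$ as $|x|\to+\infty$ such that: for some $\alpha_V,\beta_V>0$, $\langle\nabla V,b\rangle\le-\alpha_VV+\beta_V$; for some $C_{V,\sigma}>0$ and $a\in(0,1]$, $\mathrm{Tr}(\sigma^*(\nabla V)^{\otimes2}\sigma)\le C_{V,\sigma}V^{2-a}$;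 and for some $C>0$, $\sup_x\mathrm{Tr}(\sigma^*D^2V\sigma)(x)\le C\sup_x\mathrm{Tr}(\sigma^*\sigma)(x)$. **Weighted empirical measures.** $(\eta_n)_{n\ge1}$ is a sequence of positive numbers with $\sum_n\eta_n=+\infty$, $H_n=\sum_{k=1}^n\eta_k$, and $\nu_n^\eta=\frac1{H_n}\sum_{k=1}^n\eta_k\delta_{X_{k-1}}$. **Assumption (SW).** With $\Delta\frac{\eta_k}{\gamma_k}=\frac{\eta_k}{\gamma_k}-\frac{\eta_{k-1}}{\gamma_{k-1}}$ (convention $\eta_0=0$) and $x_+=\max(x,0)$: - $\lim_n\frac1{H_n}\sum_{k=1}^n\bigl|\Delta\frac{\eta_k}{\gamma_k}\bigr|=0$; - $\Bigl(\frac1{\gamma_nH_n}\bigl(\Delta\frac{\eta_n}{\gamma_n}\bigr)_+\Bigr)_n$ is nonincreasing and $\sum_n\frac1{H_n}\bigl(\Delta\frac{\eta_n}{\gamma_n}\bigr)_+<+\infty$; - there is $s\in(1,2]$ such that $\Bigl(\frac1{\gamma_n}\bigl(\frac{\eta_n}{H_n\sqrt{\gamma_n}}\bigr)^s\Bigr)_n$ is nonincreasing and $\sum_n\bigl(\frac{\eta_n}{H_n\sqrt{\gamma_n}}\bigr)^s<+\infty$. Functions $W$ are Borel measurable; (in)equalities between random variables hold almost surely. *)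

theory Defs
  imports "HOL-Probability.Probability"
begin

definition covariance_matrix :: "'a measure \<Rightarrow> ('a \<Rightarrow> real^'m) \<Rightarrow> real^'m^'m" where
  "covariance_matrix M Y = (\<chi> i j. \<integral>\<omega>. (Y \<omega> $ i - (\<integral>\<omega>'. Y \<omega>' $ i \<partial>M)) * (Y \<omega> $ j - (\<integral>\<omega>'. Y \<omega>' $ j \<partial>M)) \<partial>M)"

text \<open>The exponential moment is a nonnegative integral, so that the bound includes its
  finiteness. It makes all the integrals in the covariance matrix converge.
  The variable \<open>U 0\<close> plays no role.\<close>

definition iid_subgaussian_noise :: "'a measure \<Rightarrow> (nat \<Rightarrow> 'a \<Rightarrow> real^'m) \<Rightarrow> bool" where
  "iid_subgaussian_noise M U \<longleftrightarrow>
     prob_space.indep_vars M (\<lambda>_. borel) U {1..} \<and>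
     (\<forall>n\<ge>1. distr M borel (U n) = distr M borel (U 1)) \<and>
     covariance_matrix M (U 1) = mat 1 \<and>
     (\<exists>\<kappa>>0. \<forall>\<theta>. (\<integral>\<^sup>+\<omega>. ennreal (exp (\<theta> \<bullet> U 1 \<omega>)) \<partial>M) \<le> ennreal (exp (\<kappa> * (norm \<theta>)\<^sup>2 / 2)))"

definition noise_filtration :: "'a measure \<Rightarrow> (nat \<Rightarrow> 'a \<Rightarrow> real^'m) \<Rightarrow> nat \<Rightarrow> 'a measure" where
  "noise_filtration M U n = sigma (space M) {U i -` A \<inter> space M | i A. i \<in> {1..n} \<and> A \<in> sets borel}"

definition truncated_step :: "(nat \<Rightarrow> real) \<Rightarrow> (nat \<Rightarrow> 'a \<Rightarrow> real) \<Rightarrow> nat \<Rightarrow> 'a \<Rightarrow> real" where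
  "truncated_step \<gamma> \<xi> n \<omega> = (case n of 0 \<Rightarrow> \<gamma> 0 | Suc k \<Rightarrow> min (\<gamma> (Suc k)) (\<xi> k \<omega>))"

primrec euler_scheme ::
  "(real^'d \<Rightarrow> real^'d) \<Rightarrow> (real^'d \<Rightarrow> real^'m^'d) \<Rightarrow> real^'d \<Rightarrow>
   (nat \<Rightarrow> 'a \<Rightarrow> real) \<Rightarrow> (nat \<Rightarrow> 'a \<Rightarrow> real^'m) \<Rightarrow> nat \<Rightarrow> 'a \<Rightarrow> real^'d" where
  "euler_scheme b \<sigma> x\<^sub>0 g U 0 \<omega> = x\<^sub>0"
| "euler_scheme b \<sigma> x\<^sub>0 g U (Suc n) \<omega> =
     euler_scheme b \<sigma> x\<^sub>0 g U n \<omega> + g (Suc n) \<omega> *\<^sub>R b (euler_scheme b \<sigma> x\<^sub>0 g U n \<omega>)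
     + sqrt (g (Suc n) \<omega>) *\<^sub>R (\<sigma> (euler_scheme b \<sigma> x\<^sub>0 g U n \<omega>) *v U (Suc n) \<omega>)"

definition tensor_square :: "real^'d \<Rightarrow> real^'d^'d" where
  "tensor_square v = (\<chi> i j. v $ i * v $ j)"

text \<open>\<open>DV\<close> and \<open>D2V\<close> are the gradient and the Hessian of \<open>V\<close>. The suprema in the last condition
  may be infinite and are taken in the extended reals.\<close>

definition lyapunov_condition :: "(real^'d \<Rightarrow> real^'d) \<Rightarrow> (real^'d \<Rightarrow> real^'m^'d) \<Rightarrow> bool" where
  "lyapunov_condition b \<sigma> \<longleftrightarrow>
     (\<exists>(V :: real^'d \<Rightarrow> real) DV D2V.
        (\<forall>x. V x \<ge> 1) \<and>
        (\<forall>x. GDERIV V x :> DV x) \<and>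
        (\<forall>x. (DV has_derivative (\<lambda>h. D2V x *v h)) (at x)) \<and>
        continuous_on UNIV D2V \<and>
        filterlim V at_top at_infinity \<and>
        (\<exists>\<alpha>\<^sub>V>0. \<exists>\<beta>\<^sub>V>0. \<forall>x. DV x \<bullet> b x \<le> - \<alpha>\<^sub>V * V x + \<beta>\<^sub>V) \<and>
        (\<exists>C\<^sub>V>0. \<exists>a. 0 < a \<and> a \<le> 1 \<and>
           (\<forall>x. trace (transpose (\<sigma> x) ** tensor_square (DV x) ** \<sigma> x) \<le> C\<^sub>V * V x powr (2 - a))) \<and>
        (\<exists>C>0. (SUP x. ereal (trace (transpose (\<sigma> x) ** D2V x ** \<sigma> x)))
                 \<le> ereal C * (SUP x. ereal (trace (transpose (\<sigma> x) ** \<sigma> x)))))"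

definition cumulative_weight :: "(nat \<Rightarrow> real) \<Rightarrow> nat \<Rightarrow> real" where
  "cumulative_weight \<eta> n = (\<Sum>k=1..n. \<eta> k)"

text \<open>The measure giving mass \<open>\<eta> k / H n\<close> to the point \<open>X (k - 1) \<omega>\<close>, for \<open>1 \<le> k \<le> n\<close>,
  as an image of a weighted counting measure on the indices.\<close>

definition weighted_empirical_measure ::
  "(nat \<Rightarrow> real) \<Rightarrow> (nat \<Rightarrow> 'a \<Rightarrow> real^'d) \<Rightarrow> nat \<Rightarrow> 'a \<Rightarrow> (real^'d) measure" where
  "weighted_empirical_measure \<eta> X n \<omega> =
     distr (point_measure {1..n} (\<lambda>k. ennreal (\<eta> k / cumulative_weight \<eta> n))) borel (\<lambda>k. X (k - 1) \<omega>)"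

text \<open>Only used for \<open>k \<ge> 1\<close> and with \<open>\<eta> 0 = 0\<close>.\<close>

definition ratio_increment :: "(nat \<Rightarrow> real) \<Rightarrow> (nat \<Rightarrow> real) \<Rightarrow> nat \<Rightarrow> real" where
  "ratio_increment \<gamma> \<eta> k = \<eta> k / \<gamma> k - \<eta> (k - 1) / \<gamma> (k - 1)"

text \<open>All sequences here are indexed from 1.\<close>

definition step_weight_SW :: "(nat \<Rightarrow> real) \<Rightarrow> (nat \<Rightarrow> real) \<Rightarrow> bool" where
  "step_weight_SW \<gamma> \<eta> \<longleftrightarrow>
     (let H = cumulative_weight \<eta>; \<Delta> = ratio_increment \<gamma> \<eta> in
       (\<lambda>n. 1 / H n * (\<Sum>k=1..n. \<bar>\<Delta> k\<bar>)) \<longlonglongrightarrow> 0 \<and>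
       antimono_on {1..} (\<lambda>n. 1 / (\<gamma> n * H n) * max (\<Delta> n) 0) \<and>
       summable (\<lambda>n. 1 / H (Suc n) * max (\<Delta> (Suc n)) 0) \<and>
       (\<exists>s. 1 < s \<and> s \<le> 2 \<and>
          antimono_on {1..} (\<lambda>n. 1 / \<gamma> n * (\<eta> n / (H n * sqrt (\<gamma> n))) powr s) \<and>
          summable (\<lambda>n. (\<eta> (Suc n) / (H (Suc n) * sqrt (\<gamma> (Suc n)))) powr s)))"

text \<open>For nonnegative \<open>Y\<close>, which need not be integrable: the conditional expectation given \<open>F\<close> of
  \<open>\<bar>Y - E[Y | F]\<bar>\<close> to the power \<open>s\<close>, in \<open>[0, \<infinity>]\<close>. The deviation is infinite where \<open>E[Y | F]\<close> is.\<close>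

definition cond_central_abs_moment ::
  "'a measure \<Rightarrow> 'a measure \<Rightarrow> ('a \<Rightarrow> real) \<Rightarrow> real \<Rightarrow> 'a \<Rightarrow> ennreal" where
  "cond_central_abs_moment M F Y s =
     (let m = nn_cond_exp M F (\<lambda>\<omega>. ennreal (Y \<omega>)) in
      nn_cond_exp M F (\<lambda>\<omega>. if m \<omega> = \<infinity> then \<infinity> else ennreal (\<bar>Y \<omega> - enn2real (m \<omega>)\<bar> powr s)))"

end

theory Submission
  imports Defs
begin

text \<open>By the drift condition, \<open>\<alpha> \<eta>\<^sub>k W(X\<^sub>k\<^sub>-\<^sub>1)\<close> is eventually at most
  \<open>(\<eta>\<^sub>k/\<gamma>\<^sub>k) (W(X\<^sub>k\<^sub>-\<^sub>1) - W(X\<^sub>k)) + (\<eta>\<^sub>k/\<gamma>\<^sub>k) (W(X\<^sub>k) - E[W(X\<^sub>k) | F\<^sub>k\<^sub>-\<^sub>1]) + \<beta> \<eta>\<^sub>k\<close>.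
  Summation by parts reduces the claim to two almost sure statements.
  The sums of the centred terms, weighted by \<open>\<eta>\<^sub>k/(H\<^sub>k \<gamma>\<^sub>k)\<close>, are bounded: stop them, bound
  their moments of order \<open>s\<close> as von Bahr and Esseen do, and apply Markov's inequality.
  The series of \<open>f\<^sub>k \<gamma>\<^sub>k W(X\<^sub>k\<^sub>-\<^sub>1)\<close> converges, where \<open>f\<^sub>k = (\<Delta>(\<eta>\<^sub>k/\<gamma>\<^sub>k))\<^sub>+/(\<gamma>\<^sub>k H\<^sub>k)\<close> is
  nonincreasing: then \<open>f\<^sub>k\<^sub>+\<^sub>1 W(X\<^sub>k)\<close> decreases in conditional mean by the \<open>k\<close>-th
  term times \<open>\<alpha>\<close>, up to the summable error \<open>\<beta> \<gamma>\<^sub>k f\<^sub>k\<close>. That argument uses the truncated steps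
  throughout, which are at most \<open>\<gamma>\<^sub>k\<close>; they are replaced by \<open>\<gamma>\<^sub>k\<close> only at the end.\<close>

section \<open>A tangent inequality for powers\<close>

lemma powr_add_le_add_powr:
  fixes x y p :: real
  assumes "0 \<le> x" "0 \<le> y" "0 < p" "p \<le> 1"
  shows "(x + y) powr p \<le> x powr p + y powr p"
proof (cases "x + y = 0")
  case False
  define t where "t = x + y"
  have t: "t > 0" using assms False by (simp add: t_def)
  have le: "z / t \<le> (z / t) powr p" if "0 \<le> z" "z \<le> t" for z
  proof (cases "z = 0")
    case False
    then show ?thesis using powr_mono'[of p 1 "z / t"] that t assms by simp
  qed simp
  have "1 = x / t + y / t" using t by (simp add: add_divide_distrib[symmetric] t_def[symmetric])
  also have "\<dots> \<le> (x / t) powr p + (y / t) powr p"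
    using le[of x] le[of y] assms by (simp add: t_def)
  also have "\<dots> = (x powr p + y powr p) / t powr p"
    using t assms by (simp add: powr_divide add_divide_distrib)
  finally show ?thesis using t by (simp add: pos_le_divide_eq t_def)
qed (use assms in auto)

definition signed_powr :: "real \<Rightarrow> real \<Rightarrow> real" where
  "signed_powr p x = sgn x * \<bar>x\<bar> powr p"

lemma signed_powr_measurable [measurable]: "signed_powr p \<in> borel_measurable borel"
  unfolding signed_powr_def[abs_def] by measurable

lemma abs_signed_powr_le: "\<bar>signed_powr p x\<bar> \<le> \<bar>x\<bar> powr p"
  by (simp add: signed_powr_def abs_mult sgn_if)

lemma abs_powr_diff_le:
  fixes x y p :: real
  assumes "0 \<le> x" "0 \<le> y" "0 < p" "p \<le> 1"
  shows "\<bar>x powr p - y powr p\<bar> \<le> \<bar>x - y\<bar> powr p"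
proof (cases "x \<le> y")
  case True
  then show ?thesis
    using powr_add_le_add_powr[of x "y - x" p] powr_mono2[of p x y] assms by simp
next
  case False
  then show ?thesis
    using powr_add_le_add_powr[of y "x - y" p] powr_mono2[of p y x] assms by simp
qed

lemma signed_powr_holder:
  fixes x y p :: real
  assumes "0 < p" "p \<le> 1"
  shows "\<bar>signed_powr p x - signed_powr p y\<bar> \<le> 2 * \<bar>x - y\<bar> powr p"
proof -
  have same: "\<bar>\<bar>x\<bar> powr p - \<bar>y\<bar> powr p\<bar> \<le> \<bar>x - y\<bar> powr p" if "x * y \<ge> 0"
  proof -
    have "\<bar>\<bar>x\<bar> - \<bar>y\<bar>\<bar> = \<bar>x - y\<bar>" using that by (auto simp: zero_le_mult_iff abs_if)
    then show ?thesis using abs_powr_diff_le[of "\<bar>x\<bar>" "\<bar>y\<bar>" p] assms by simp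
  qed
  have mono: "\<bar>x\<bar> powr p \<le> \<bar>x - y\<bar> powr p \<and> \<bar>y\<bar> powr p \<le> \<bar>x - y\<bar> powr p" if "x * y < 0"
    using that assms by (intro conjI powr_mono2) (auto simp: mult_less_0_iff)
  show ?thesis
  proof (cases "x * y \<ge> 0")
    case True
    have "\<bar>signed_powr p x - signed_powr p y\<bar> \<le> \<bar>x - y\<bar> powr p"
      using same[OF True] True
      by (cases "x = 0"; cases "y = 0") (auto simp: signed_powr_def zero_le_mult_iff sgn_if)
    then show ?thesis using powr_ge_zero[of "\<bar>x - y\<bar>" p] by linarith
  next
    case False
    have "\<bar>signed_powr p x - signed_powr p y\<bar> \<le> \<bar>x\<bar> powr p + \<bar>y\<bar> powr p"
      using abs_signed_powr_le[of p x] abs_signed_powr_le[of p y] by linarith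
    then show ?thesis using mono False by linarith
  qed
qed

lemma abs_powr_tangent:
  fixes a y s :: real
  assumes "1 < s"
  shows "\<bar>y\<bar> powr s + s * signed_powr (s - 1) y * (a - y) \<le> \<bar>a\<bar> powr s"
proof (cases "a = 0 \<or> y = 0")
  case True
  have "\<bar>y\<bar> powr s + s * signed_powr (s - 1) y * (0 - y) = (1 - s) * \<bar>y\<bar> powr s"
    using assms by (cases "y = 0") (auto simp: signed_powr_def sgn_if powr_diff algebra_simps)
  also have "\<dots> \<le> 0" using assms by (simp add: mult_nonpos_nonneg)
  finally have "\<bar>y\<bar> powr s + s * signed_powr (s - 1) y * (0 - y) \<le> 0" .
  then show ?thesis using True assms by (auto simp: signed_powr_def)
next
  case False
  have "signed_powr (s - 1) y * y = \<bar>y\<bar> powr s"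
    using False by (auto simp: signed_powr_def sgn_if powr_diff)
  moreover have "1 / s + (s - 1) / s = 1" using assms by (simp add: field_simps)
  then have "\<bar>a\<bar> * \<bar>y\<bar> powr (s - 1) \<le> \<bar>a\<bar> powr s / s + (s - 1) / s * \<bar>y\<bar> powr s"
    using Youngs_inequality_0[of "1/s" "(s-1)/s" "\<bar>a\<bar> powr s" "\<bar>y\<bar> powr s"] assms False
    by (simp add: powr_powr)
  moreover have "signed_powr (s - 1) y * a \<le> \<bar>a\<bar> * \<bar>y\<bar> powr (s - 1)"
    using mult_left_mono[OF abs_signed_powr_le[of "s - 1" y], of "\<bar>a\<bar>"]
      abs_ge_self[of "a * signed_powr (s - 1) y"]
    by (simp add: abs_mult mult.commute)
  ultimately have "s * (signed_powr (s - 1) y * a) \<le> s * (\<bar>a\<bar> powr s / s + (s - 1) / s * \<bar>y\<bar> powr s)"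
    using assms by simp
  also have "\<dots> = \<bar>a\<bar> powr s + (s - 1) * \<bar>y\<bar> powr s" using assms by (simp add: field_simps)
  finally show ?thesis using \<open>signed_powr (s - 1) y * y = \<bar>y\<bar> powr s\<close>
    by (simp add: algebra_simps)
qed

lemma abs_add_powr_le:
  fixes a b s :: real
  assumes "1 < s" "s \<le> 2"
  shows "\<bar>a + b\<bar> powr s \<le> \<bar>a\<bar> powr s + s * signed_powr (s - 1) a * b + 2 * s * \<bar>b\<bar> powr s"
proof -
  have "(signed_powr (s - 1) (a + b) - signed_powr (s - 1) a) * b \<le> (2 * \<bar>b\<bar> powr (s - 1)) * \<bar>b\<bar>"
    using signed_powr_holder[of "s - 1" "a + b" a] assms
      abs_le_D1[of "(signed_powr (s - 1) (a + b) - signed_powr (s - 1) a) * b" "(2 * \<bar>b\<bar> powr (s - 1)) * \<bar>b\<bar>"]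
    by (simp add: abs_mult mult_right_mono)
  also have "\<dots> = 2 * \<bar>b\<bar> powr s" by (cases "b = 0") (auto simp: powr_diff)
  finally have "s * ((signed_powr (s - 1) (a + b) - signed_powr (s - 1) a) * b) \<le> s * (2 * \<bar>b\<bar> powr s)"
    using assms by simp
  then show ?thesis using abs_powr_tangent[of s "a + b" a] assms by (simp add: algebra_simps)
qed

section \<open>Summation by parts\<close>

lemma sum_weighted_increments_le:
  fixes H d :: "nat \<Rightarrow> real"
  assumes "mono H" "0 \<le> H 0" "\<And>n. \<bar>\<Sum>k<n. d k\<bar> \<le> K"
  shows "(\<Sum>k<n. H (Suc k) * d k) \<le> 2 * K * H n"
proof -
  define S where "S n = (\<Sum>k<n. d k)" for n
  have eq: "(\<Sum>k<n. H (Suc k) * d k) = H n * S n - (\<Sum>k<n. (H (Suc k) - H k) * S k)" for n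
    by (induction n) (auto simp: S_def algebra_simps)
  have K: "0 \<le> K" using assms(3)[of 0] by simp
  have H: "0 \<le> H n" using assms(2) monoD[OF assms(1), of 0 n] by simp
  have "- (\<Sum>k<n. (H (Suc k) - H k) * S k) \<le> (\<Sum>k<n. (H (Suc k) - H k) * K)"
    unfolding sum_negf[symmetric]
  proof (rule sum_mono)
    fix k
    have "(H (Suc k) - H k) * (- S k) \<le> (H (Suc k) - H k) * K"
      using assms(3)[of k] monoD[OF assms(1), of k "Suc k"] by (intro mult_left_mono) (auto simp: S_def)
    then show "- ((H (Suc k) - H k) * S k) \<le> (H (Suc k) - H k) * K" by simp
  qed
  also have "\<dots> = (H n - H 0) * K"
    by (simp add: sum_distrib_right[symmetric] sum_lessThan_telescope)
  also have "\<dots> \<le> H n * K" using K assms(2) by (simp add: mult_right_mono)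
  finally have "- (\<Sum>k<n. (H (Suc k) - H k) * S k) \<le> H n * K" .
  moreover have "H n * S n \<le> H n * K"
    using assms(3)[of n] H by (intro mult_left_mono) (auto simp: S_def)
  ultimately show ?thesis unfolding eq by (simp add: algebra_simps)
qed

lemma weighted_average_bounded:
  fixes \<gamma> \<eta> w m :: "nat \<Rightarrow> real" and \<alpha> \<beta> :: real
  defines "H \<equiv> \<lambda>n. \<Sum>k=1..n. \<eta> k"
    and "\<Delta> \<equiv> \<lambda>k. \<eta> k / \<gamma> k - \<eta> (k - 1) / \<gamma> (k - 1)"
  assumes \<gamma>: "\<And>n. 0 < \<gamma> n" and \<eta>: "\<And>n. n \<ge> 1 \<Longrightarrow> 0 < \<eta> n" "\<eta> 0 = 0"
    and w: "\<And>n. 0 \<le> w n" and \<alpha>: "0 < \<alpha>"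
    and drift: "\<And>k. k \<ge> N \<Longrightarrow> m k \<le> w k + \<gamma> (Suc k) * (\<beta> - \<alpha> * w k)"
    and mart: "\<And>n. \<bar>\<Sum>k<n. \<eta> (Suc k) / (H (Suc k) * \<gamma> (Suc k)) * (w (Suc k) - m k)\<bar> \<le> K"
    and summ: "summable (\<lambda>k. max (\<Delta> (Suc k)) 0 / H (Suc k) * w k)"
  shows "\<exists>C. \<forall>n\<ge>1. (\<Sum>k<n. \<eta> (Suc k) * w k) \<le> C * H n"
proof -
  define r where "r k = \<eta> k / \<gamma> k" for k
  define d where "d k = \<eta> (Suc k) / (H (Suc k) * \<gamma> (Suc k)) * (w (Suc k) - m k)" for k
  define P where "P n = (\<Sum>k<n. \<eta> (Suc k) * w k)" for n
  define L where "L = (\<Sum>k. max (\<Delta> (Suc k)) 0 / H (Suc k) * w k)"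
  have H_Suc: "H (Suc n) = H n + \<eta> (Suc n)" for n by (simp add: H_def)
  have H0: "H 0 = 0" by (simp add: H_def)
  have mono_H: "mono H" using \<eta>(1) by (intro incseq_SucI) (simp add: H_Suc less_imp_le)
  have H_pos: "0 < H n" "H 1 \<le> H n" if "n \<ge> 1" for n
    using monoD[OF mono_H that] \<eta>(1)[of 1] H_Suc[of 0] H0 by simp_all
  have r: "0 \<le> r n" for n
    using \<eta>(1)[of n] \<eta>(2) \<gamma>[of n] by (cases "n = 0") (simp_all add: r_def)
  have mart_part: "(\<Sum>k<n. H (Suc k) * d k) \<le> 2 * K * H n" for n
    using sum_weighted_increments_le[OF mono_H, of d K n] H0 mart by (simp add: d_def)
  have delta_part: "(\<Sum>k<n. max (\<Delta> (Suc k)) 0 * w k) \<le> L * H n" for n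
  proof -
    have nn: "0 \<le> max (\<Delta> (Suc k)) 0 / H (Suc k) * w k" for k
      using H_pos[of "Suc k"] w[of k] by simp
    have Hn: "0 \<le> H n" using H0 H_pos[of n] by (cases n) auto
    have "(\<Sum>k<n. max (\<Delta> (Suc k)) 0 * w k) \<le> (\<Sum>k<n. max (\<Delta> (Suc k)) 0 / H (Suc k) * w k * H n)"
    proof (rule sum_mono)
      fix k assume "k \<in> {..<n}"
      then have "H (Suc k) \<le> H n" by (intro monoD[OF mono_H]) simp
      then have "max (\<Delta> (Suc k)) 0 / H (Suc k) * w k * H (Suc k)
          \<le> max (\<Delta> (Suc k)) 0 / H (Suc k) * w k * H n"
        using nn[of k] by (rule mult_left_mono)
      then show "max (\<Delta> (Suc k)) 0 * w k \<le> max (\<Delta> (Suc k)) 0 / H (Suc k) * w k * H n"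
        using H_pos[of "Suc k"] by simp
    qed
    also have "\<dots> \<le> L * H n"
      unfolding L_def sum_distrib_right[symmetric]
      using nn Hn by (intro mult_right_mono sum_le_suminf summ) auto
    finally show ?thesis .
  qed
  define R where "R n = \<beta> * H n + (\<Sum>k<n. max (\<Delta> (Suc k)) 0 * w k) + (\<Sum>k<n. H (Suc k) * d k)" for n
  define C0 where "C0 = \<alpha> * P N + r N * w N - R N"
  have main: "\<alpha> * P n + r n * w n \<le> C0 + R n" if "n \<ge> N" for n
    using that
  proof (induction n rule: dec_induct)
    case base
    then show ?case by (simp add: C0_def)
  next
    case (step n)
    have "H (Suc n) * d n = r (Suc n) * (w (Suc n) - m n)"
      using H_pos[of "Suc n"] by (simp add: d_def r_def)
    moreover have "r (Suc n) * m n \<le> r (Suc n) * (w n + \<gamma> (Suc n) * (\<beta> - \<alpha> * w n))"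
      using drift[OF step.hyps(1)] r by (rule mult_left_mono)
    moreover have "r (Suc n) * (w n + \<gamma> (Suc n) * (\<beta> - \<alpha> * w n))
        = r (Suc n) * w n + \<eta> (Suc n) * (\<beta> - \<alpha> * w n)"
      using \<gamma>[of "Suc n"] by (simp add: r_def field_simps)
    moreover have "r (Suc n) * w n = r n * w n + \<Delta> (Suc n) * w n"
      by (simp add: r_def \<Delta>_def algebra_simps)
    moreover have "\<Delta> (Suc n) * w n \<le> max (\<Delta> (Suc n)) 0 * w n"
      using w[of n] by (intro mult_right_mono) auto
    ultimately show ?case
      using step.IH by (simp add: P_def R_def H_Suc algebra_simps)
  qed
  have mono_P: "mono P" using \<eta>(1) w by (intro incseq_SucI) (simp add: P_def less_imp_le)
  define C where "C = max (P N / H 1) ((\<bar>C0\<bar> / H 1 + \<bar>\<beta>\<bar> + L + 2 * K) / \<alpha>)"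
  have "P n \<le> C * H n" if n: "n \<ge> 1" for n
  proof (cases "n \<ge> N")
    case True
    have "\<alpha> * P n \<le> C0 + R n" using main[OF True] r[of n] w[of n] mult_nonneg_nonneg[of "r n" "w n"] by linarith
    also have "C0 \<le> \<bar>C0\<bar> / H 1 * H n"
    proof -
      have "\<bar>C0\<bar> / H 1 * H 1 \<le> \<bar>C0\<bar> / H 1 * H n"
        using H_pos[OF n] H_pos[of 1] by (intro mult_left_mono) auto
      then show ?thesis using H_pos[of 1] by simp
    qed
    also have "R n \<le> (\<bar>\<beta>\<bar> + L + 2 * K) * H n"
    proof -
      have "\<beta> * H n \<le> \<bar>\<beta>\<bar> * H n" using H_pos[OF n] by (intro mult_right_mono) auto
      then show ?thesis
        using mart_part[of n] delta_part[of n] by (simp add: R_def algebra_simps)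
    qed
    finally have "\<alpha> * P n \<le> (\<bar>C0\<bar> / H 1 + \<bar>\<beta>\<bar> + L + 2 * K) * H n"
      by (simp add: algebra_simps)
    then have "P n \<le> (\<bar>C0\<bar> / H 1 + \<bar>\<beta>\<bar> + L + 2 * K) / \<alpha> * H n"
      using \<alpha> by (simp add: field_simps)
    also have "\<dots> \<le> C * H n" using H_pos[OF n] by (intro mult_right_mono) (auto simp: C_def)
    finally show ?thesis .
  next
    case False
    have "0 \<le> P N" using monoD[OF mono_P, of 0 N] by (simp add: P_def)
    have "P n \<le> P N" using False by (intro monoD[OF mono_P]) simp
    also have "P N = P N / H 1 * H 1" using H_pos[of 1] by simp
    also have "\<dots> \<le> P N / H 1 * H n" using H_pos[OF n] H_pos[of 1] \<open>0 \<le> P N\<close> by (intro mult_left_mono) auto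
    also have "\<dots> \<le> C * H n" using H_pos[OF n] by (intro mult_right_mono) (auto simp: C_def)
    finally show ?thesis .
  qed
  then show ?thesis unfolding P_def by blast
qed

section \<open>Sums of centred variables\<close>

lemma (in sigma_finite_subalgebra) integral_mult_diff_cond_exp_nonneg:
  fixes Y h :: "'a \<Rightarrow> real"
  assumes [measurable]: "Y \<in> borel_measurable M" "h \<in> borel_measurable F"
    and fin: "finite_measure M"
    and Y: "\<And>x. 0 \<le> Y x" and h: "\<And>x. 0 \<le> h x"
    and m: "AE x in M. h x \<noteq> 0 \<longrightarrow> nn_cond_exp M F (\<lambda>x. ennreal (Y x)) x < \<infinity>"
    and int: "integrable M (\<lambda>x. h x * (Y x - enn2real (nn_cond_exp M F (\<lambda>x. ennreal (Y x)) x)))"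
  shows "(\<integral>x. h x * (Y x - enn2real (nn_cond_exp M F (\<lambda>x. ennreal (Y x)) x)) \<partial>M) = 0"
proof -
  interpret finite_measure M by fact
  define e where "e = nn_cond_exp M F (\<lambda>x. ennreal (Y x))"
  have [measurable]: "e \<in> borel_measurable F" "e \<in> borel_measurable M"
    unfolding e_def by measurable
  have hM [measurable]: "h \<in> borel_measurable M" by (rule measurable_from_subalg[OF subalg]) fact
  define g where "g K x = (if e x \<le> ennreal (real K) \<and> h x \<le> real K then h x else 0)" for K :: nat and x
  have gF [measurable]: "g K \<in> borel_measurable F" for K
    unfolding g_def[abs_def] by measurable
  have gM [measurable]: "g K \<in> borel_measurable M" for K
    by (rule measurable_from_subalg[OF subalg gF])
  have g: "0 \<le> g K x" for K x using h by (simp add: g_def)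
  have ge: "g K x * enn2real (e x) \<le> real K * real K" "ennreal (g K x) * e x = ennreal (g K x * enn2real (e x))" for K x
  proof -
    show "g K x * enn2real (e x) \<le> real K * real K"
      using h[of x] by (auto simp: g_def enn2real_leI intro!: mult_mono)
    show "ennreal (g K x) * e x = ennreal (g K x * enn2real (e x))"
    proof (cases "e x \<le> ennreal (real K)")
      case True
      then have "e x < top" by (auto simp: top.not_eq_extremum intro: le_less_trans)
      then show ?thesis using g[of K x] by (simp add: ennreal_mult)
    qed (simp add: g_def)
  qed
  have trunc: "(\<integral>x. g K x * (Y x - enn2real (e x)) \<partial>M) = 0" for K
  proof -
    have int_e: "integrable M (\<lambda>x. g K x * enn2real (e x))"
      by (rule integrable_const_bound[where B = "real K * real K"]) (use ge(1) g in auto)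
    have eq: "(\<integral>\<^sup>+x. ennreal (g K x * Y x) \<partial>M) = (\<integral>\<^sup>+x. ennreal (g K x * enn2real (e x)) \<partial>M)"
    proof -
      have "(\<integral>\<^sup>+x. ennreal (g K x * Y x) \<partial>M) = (\<integral>\<^sup>+x. ennreal (g K x) * ennreal (Y x) \<partial>M)"
        using g Y by (simp add: ennreal_mult)
      also have "\<dots> = (\<integral>\<^sup>+x. ennreal (g K x) * e x \<partial>M)"
        unfolding e_def by (rule nn_cond_exp_intg[symmetric]) auto
      finally show ?thesis using ge(2) by simp
    qed
    have "(\<integral>\<^sup>+x. ennreal (g K x * enn2real (e x)) \<partial>M) < \<infinity>"
      using int_e g by (simp add: integrable_iff_bounded)
    then have int_Y: "integrable M (\<lambda>x. g K x * Y x)"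
      using eq g Y by (simp add: integrable_iff_bounded)
    have "(\<integral>x. g K x * Y x \<partial>M) = (\<integral>x. g K x * enn2real (e x) \<partial>M)"
      using g Y eq by (subst (1 2) integral_eq_nn_integral) (auto simp: eq)
    then show ?thesis using int_Y int_e by (simp add: right_diff_distrib)
  qed
  have "(\<lambda>K. \<integral>x. g K x * (Y x - enn2real (e x)) \<partial>M) \<longlonglongrightarrow> (\<integral>x. h x * (Y x - enn2real (e x)) \<partial>M)"
  proof (rule integral_dominated_convergence[where w = "\<lambda>x. \<bar>h x * (Y x - enn2real (e x))\<bar>"])
    show "integrable M (\<lambda>x. \<bar>h x * (Y x - enn2real (e x))\<bar>)"
      using int by (simp add: e_def)
    show "AE x in M. norm (g K x * (Y x - enn2real (e x))) \<le> \<bar>h x * (Y x - enn2real (e x))\<bar>" for K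
      by (simp add: g_def)
    show "AE x in M. (\<lambda>K. g K x * (Y x - enn2real (e x))) \<longlonglongrightarrow> h x * (Y x - enn2real (e x))"
      using m
    proof eventually_elim
      case (elim x)
      show ?case
      proof (cases "h x = 0")
        case True
        then have "g K x = 0" for K by (simp add: g_def)
        then show ?thesis using True by simp
      next
        case False
        then have "e x < top" using elim by (simp add: e_def)
        then have "e x = ennreal (enn2real (e x))" by simp
        have "eventually (\<lambda>K. enn2real (e x) \<le> real K \<and> h x \<le> real K) sequentially"
          using filterlim_real_sequentially unfolding filterlim_at_top
          by (intro eventually_conj) auto
        then have "eventually (\<lambda>K. g K x * (Y x - enn2real (e x)) = h x * (Y x - enn2real (e x))) sequentially"
        proof eventually_elim
          case (elim K)
          then have "e x \<le> ennreal (real K)"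
            by (subst \<open>e x = ennreal (enn2real (e x))\<close>) (simp add: ennreal_leI)
          then show ?case using elim by (simp add: g_def)
        qed
        then show ?thesis by (rule tendsto_eventually)
      qed
    qed
  qed auto
  then have "(\<lambda>K::nat. 0::real) \<longlonglongrightarrow> (\<integral>x. h x * (Y x - enn2real (e x)) \<partial>M)"
    by (simp add: trunc)
  then show ?thesis unfolding e_def by (simp add: LIMSEQ_const_iff)
qed

lemma (in sigma_finite_subalgebra) integral_mult_diff_cond_exp:
  fixes Y h :: "'a \<Rightarrow> real"
  assumes [measurable]: "Y \<in> borel_measurable M" "h \<in> borel_measurable F"
    and fin: "finite_measure M"
    and Y: "\<And>x. 0 \<le> Y x"
    and m: "AE x in M. h x \<noteq> 0 \<longrightarrow> nn_cond_exp M F (\<lambda>x. ennreal (Y x)) x < \<infinity>"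
    and int: "integrable M (\<lambda>x. h x * (Y x - enn2real (nn_cond_exp M F (\<lambda>x. ennreal (Y x)) x)))"
  shows "(\<integral>x. h x * (Y x - enn2real (nn_cond_exp M F (\<lambda>x. ennreal (Y x)) x)) \<partial>M) = 0"
proof -
  define D where "D x = Y x - enn2real (nn_cond_exp M F (\<lambda>x. ennreal (Y x)) x)" for x
  have [measurable]: "D \<in> borel_measurable M" unfolding D_def[abs_def] by measurable
  have hM [measurable]: "h \<in> borel_measurable M" by (rule measurable_from_subalg[OF subalg]) fact
  have int': "integrable M (\<lambda>x. max (h x) 0 * D x)" "integrable M (\<lambda>x. max (- h x) 0 * D x)"
    by (rule Bochner_Integration.integrable_bound[OF int]; auto simp: D_def abs_mult intro!: mult_right_mono)+
  have "(\<integral>x. max (h x) 0 * D x \<partial>M) = 0" "(\<integral>x. max (- h x) 0 * D x \<partial>M) = 0"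
    unfolding D_def
    by (rule integral_mult_diff_cond_exp_nonneg;
        (use fin Y m int'[unfolded D_def] in \<open>auto split: if_splits\<close>))+
  moreover have "(\<lambda>x. h x * D x) = (\<lambda>x. max (h x) 0 * D x - max (- h x) 0 * D x)"
    by (auto simp: max_def)
  ultimately show ?thesis using int' unfolding D_def[symmetric] by simp
qed

lemma measurable_filtration_mono:
  assumes "\<And>n. subalgebra M (F n)" "\<And>n. sets (F n) \<subseteq> sets (F (Suc n))"
    and "f \<in> measurable (F i) N" "i \<le> j"
  shows "f \<in> measurable (F j) N"
proof (rule measurable_from_subalg[OF _ assms(3)])
  show "subalgebra (F j) (F i)"
    using assms(1)[of i] assms(1)[of j] lift_Suc_mono_le[of "\<lambda>n. sets (F n)" i j] assms(2,4)
    by (auto simp: subalgebra_def)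
qed

locale centred_sums = prob_space M for M :: "'a measure" +
  fixes F :: "nat \<Rightarrow> 'a measure" and Y :: "nat \<Rightarrow> 'a \<Rightarrow> real" and c :: "nat \<Rightarrow> real" and s :: real
  assumes subalg: "\<And>n. subalgebra M (F n)"
    and filtration: "\<And>n. sets (F n) \<subseteq> sets (F (Suc n))"
    and Y_measurable: "\<And>n. Y n \<in> borel_measurable (F (Suc n))"
    and Y_nonneg: "\<And>n x. 0 \<le> Y n x"
    and c_pos: "\<And>n. 0 < c n"
    and s: "1 < s" "s \<le> 2"
begin

sublocale sub: finite_measure_subalgebra M "F n" for n
  by unfold_locales (rule subalg)

definition cond_mean :: "nat \<Rightarrow> 'a \<Rightarrow> ennreal" where
  "cond_mean n = nn_cond_exp M (F n) (\<lambda>x. ennreal (Y n x))"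

definition increment :: "nat \<Rightarrow> 'a \<Rightarrow> real" where
  "increment n x = c n * (Y n x - enn2real (cond_mean n x))"

definition partial_sum :: "nat \<Rightarrow> 'a \<Rightarrow> real" where
  "partial_sum n x = (\<Sum>k<n. increment k x)"

definition cond_moment :: "nat \<Rightarrow> 'a \<Rightarrow> ennreal" where
  "cond_moment n x = ennreal (c n powr s) * cond_central_abs_moment M (F n) (Y n) s x"

lemma measurable_F_mono: "f \<in> measurable (F i) N \<Longrightarrow> i \<le> j \<Longrightarrow> f \<in> measurable (F j) N"
  by (rule measurable_filtration_mono[where M = M and F = F, OF subalg filtration])

lemma measurable_F_M: "f \<in> measurable (F i) N \<Longrightarrow> f \<in> measurable M N"
  by (rule measurable_from_subalg[OF subalg])

lemma Y_M [measurable]: "Y n \<in> borel_measurable M"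
  by (rule measurable_F_M[OF Y_measurable])

lemma cond_mean_F: "cond_mean n \<in> borel_measurable (F n)"
  unfolding cond_mean_def by measurable

lemma cond_mean_M [measurable]: "cond_mean n \<in> borel_measurable M"
  by (rule measurable_F_M[OF cond_mean_F])

lemma increment_F: "increment n \<in> borel_measurable (F (Suc n))"
proof -
  note [measurable] = Y_measurable measurable_F_mono[OF cond_mean_F, of n "Suc n"]
  show ?thesis unfolding increment_def[abs_def] by measurable
qed

lemma partial_sum_F: "j \<le> n \<Longrightarrow> partial_sum j \<in> borel_measurable (F n)"
  unfolding partial_sum_def[abs_def]
  by (intro borel_measurable_sum measurable_F_mono[OF increment_F]) auto

lemma cond_moment_F: "cond_moment n \<in> borel_measurable (F n)"
proof -
  have [measurable]: "cond_central_abs_moment M (F n) (Y n) s \<in> borel_measurable (F n)"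
    unfolding cond_central_abs_moment_def Let_def by measurable
  show ?thesis unfolding cond_moment_def[abs_def] by measurable
qed

lemma increment_M [measurable]: "increment n \<in> borel_measurable M"
  by (rule measurable_F_M[OF increment_F])

lemma partial_sum_M [measurable]: "partial_sum n \<in> borel_measurable M"
  by (rule measurable_F_M[OF partial_sum_F[OF order_refl]])

lemma cond_moment_M [measurable]: "cond_moment n \<in> borel_measurable M"
  by (rule measurable_F_M[OF cond_moment_F])

text \<open>A maximal inequality by stopping: \<open>T\<close> is the sum stopped as soon as it leaves
  \<open>(-\<rho>, \<rho>)\<close> or the conditional moments exceed \<open>L\<close>. Before it stops, \<open>T\<close> is bounded and
  the increment has a finite moment, so the first-order term of \<open>abs_add_powr_le\<close> integrates to zero.\<close>

lemma maximal_inequality_upto: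
  assumes "0 \<le> L" "0 < \<rho>"
  shows "measure M {x\<in>space M. (\<forall>k. (\<Sum>j\<le>k. cond_moment j x) \<le> ennreal L) \<and> (\<exists>j\<le>n. \<rho> \<le> \<bar>partial_sum j x\<bar>)} \<le> 2 * s * L / \<rho> powr s"
proof -
  define A where "A k x = (\<Sum>j\<le>k. cond_moment j x)" for k x
  define E where "E k = {x\<in>space M. A k x \<le> ennreal L \<and> (\<forall>j\<le>k. \<bar>partial_sum j x\<bar> < \<rho>)}" for k
  define T where "T n x = (\<Sum>k<n. indicator (E k) x * increment k x)" for n x
  define Q where "Q k x = (if cond_mean k x = \<infinity> then \<infinity> else ennreal (\<bar>Y k x - enn2real (cond_mean k x)\<bar> powr s))" for k x
  have space_F: "space (F k) = space M" for k using subalg[of k] by (simp add: subalgebra_def)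
  have AF [measurable]: "A k \<in> borel_measurable (F k)" for k
    unfolding A_def[abs_def] by (intro borel_measurable_sum measurable_F_mono[OF cond_moment_F]) auto
  have EF [measurable]: "E k \<in> sets (F k)" for k
  proof -
    have "{x\<in>space (F k). \<bar>partial_sum j x\<bar> < \<rho>} \<in> sets (F k)" if "j \<le> k" for j
      using partial_sum_F[OF that] by measurable
    then have "{x\<in>space (F k). A k x \<le> ennreal L} \<inter> (\<Inter>j\<in>{..k}. {x\<in>space (F k). \<bar>partial_sum j x\<bar> < \<rho>}) \<in> sets (F k)"
      by (intro sets.Int sets.finite_INT) auto
    also have "{x\<in>space (F k). A k x \<le> ennreal L} \<inter> (\<Inter>j\<in>{..k}. {x\<in>space (F k). \<bar>partial_sum j x\<bar> < \<rho>}) = E k"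
      by (auto simp: E_def space_F)
    finally show ?thesis .
  qed
  have EM [measurable]: "E k \<in> sets M" for k
    using EF subalg[of k] by (auto simp: subalgebra_def)
  have QM [measurable]: "Q k \<in> borel_measurable M" for k
    unfolding Q_def[abs_def] by measurable
  have TF: "T n \<in> borel_measurable (F n)" for n
    unfolding T_def[abs_def]
  proof (rule borel_measurable_sum)
    fix k assume "k \<in> {..<n}"
    then have "indicat_real (E k) \<in> borel_measurable (F n)"
      by (intro measurable_F_mono[OF borel_measurable_indicator[OF EF]]) auto
    moreover have "increment k \<in> borel_measurable (F n)"
      using \<open>k \<in> {..<n}\<close> by (intro measurable_F_mono[OF increment_F]) auto
    ultimately show "(\<lambda>x. indicator (E k) x * increment k x) \<in> borel_measurable (F n)"
      by (rule borel_measurable_times)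
  qed
  have TM [measurable]: "T n \<in> borel_measurable M" for n
    by (rule measurable_F_M[OF TF])
  have E_anti: "x \<in> E j" if "x \<in> E k" "j \<le> k" for x j k
  proof -
    have "A j x \<le> A k x" using that(2) unfolding A_def by (intro sum_mono2) auto
    then show ?thesis using that unfolding E_def by (auto intro: order_trans)
  qed
  have T_eq_S: "T k x = partial_sum k x" if "\<And>i. i < k \<Longrightarrow> x \<in> E i" for k x
    using that by (simp add: T_def partial_sum_def)

  have sum_le: "(\<Sum>k<n. indicator (E k) x * cond_moment k x) \<le> ennreal L" for n x
  proof (induction n)
    case (Suc n)
    show ?case
    proof (cases "x \<in> E n")
      case True
      have "(\<Sum>k<Suc n. indicator (E k) x * cond_moment k x) \<le> (\<Sum>k<Suc n. cond_moment k x)"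
        by (intro sum_mono) (auto simp: indicator_def)
      also have "\<dots> = A n x" by (simp add: A_def lessThan_Suc_atMost)
      also have "\<dots> \<le> ennreal L" using True by (simp add: E_def)
      finally show ?thesis .
    qed (use Suc in simp)
  qed simp

  have powr_increment: "\<bar>increment k x\<bar> powr s = c k powr s * \<bar>Y k x - enn2real (cond_mean k x)\<bar> powr s" for k x
    using c_pos[of k] by (simp add: increment_def abs_mult powr_mult)
  have Q_int: "(\<integral>\<^sup>+x. indicator (E k) x * ennreal (c k powr s) * Q k x \<partial>M) = (\<integral>\<^sup>+x. indicator (E k) x * cond_moment k x \<partial>M)" for k
  proof -
    have "(\<integral>\<^sup>+x. (indicator (E k) x * ennreal (c k powr s)) * Q k x \<partial>M) =
        (\<integral>\<^sup>+x. (indicator (E k) x * ennreal (c k powr s)) * nn_cond_exp M (F k) (Q k) x \<partial>M)"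
      by (rule sub.nn_cond_exp_intg[symmetric]) measurable
    moreover have "cond_central_abs_moment M (F k) (Y k) s = nn_cond_exp M (F k) (Q k)"
      unfolding cond_central_abs_moment_def Let_def Q_def[abs_def] cond_mean_def by (rule refl)
    ultimately show ?thesis by (simp add: cond_moment_def mult.assoc)
  qed
  have Q_fin: "(\<integral>\<^sup>+x. indicator (E k) x * ennreal (c k powr s) * Q k x \<partial>M) < \<infinity>" for k
  proof -
    have "(\<integral>\<^sup>+x. indicator (E k) x * cond_moment k x \<partial>M) \<le> (\<integral>\<^sup>+x. ennreal L \<partial>M)"
    proof (rule nn_integral_mono)
      fix x
      have "indicator (E k) x * cond_moment k x \<le> (\<Sum>k<Suc k. indicator (E k) x * cond_moment k x)"
        by (simp add: add_increasing)
      then show "indicator (E k) x * cond_moment k x \<le> ennreal L" using sum_le order_trans by blast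
    qed
    also have "\<dots> < \<infinity>" by (simp add: emeasure_space_1)
    finally show ?thesis by (simp add: Q_int)
  qed
  have cond_mean_finite: "AE x in M. x \<in> E k \<longrightarrow> cond_mean k x < \<infinity>" for k
  proof -
    have "AE x in M. indicator (E k) x * ennreal (c k powr s) * Q k x \<noteq> \<infinity>"
      using Q_fin[of k] by (intro nn_integral_noteq_infinite) auto
    then show ?thesis
    proof eventually_elim
      case (elim x)
      show ?case
      proof (intro impI)
        assume "x \<in> E k"
        then have "Q k x \<noteq> \<infinity>" using elim c_pos[of k] by (auto simp: ennreal_mult_eq_top_iff)
        then show "cond_mean k x < \<infinity>" by (auto simp: Q_def top.not_eq_extremum split: if_splits)
      qed
    qed
  qed
  have increment_le: "(\<integral>\<^sup>+x. ennreal (indicator (E k) x * \<bar>increment k x\<bar> powr s) \<partial>M) \<le> (\<integral>\<^sup>+x. indicator (E k) x * cond_moment k x \<partial>M)" for k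
    unfolding Q_int[symmetric]
    by (intro nn_integral_mono) (auto simp: indicator_def powr_increment Q_def ennreal_mult intro!: mult_left_mono)
  have integrable_increment_powr: "integrable M (\<lambda>x. indicator (E k) x * \<bar>increment k x\<bar> powr s)" for k
    using increment_le[of k] Q_fin[of k] unfolding Q_int
    by (intro integrableI_nonneg) (auto intro: le_less_trans)
  have integrable_increment: "integrable M (\<lambda>x. indicator (E k) x * increment k x)" for k
  proof (rule Bochner_Integration.integrable_bound)
    show "integrable M (\<lambda>x. 1 + indicator (E k) x * \<bar>increment k x\<bar> powr s)" using integrable_increment_powr by simp
    have "\<bar>increment k x\<bar> \<le> 1 + \<bar>increment k x\<bar> powr s" for x
    proof (cases "\<bar>increment k x\<bar> \<le> 1")
      case True
      then show ?thesis using powr_ge_zero[of "\<bar>increment k x\<bar>" s] by linarith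
    next
      case False
      then have "\<bar>increment k x\<bar> powr 1 \<le> \<bar>increment k x\<bar> powr s" using s by (intro powr_mono) auto
      then show ?thesis using False by simp
    qed
    then show "AE x in M. norm (indicator (E k) x * increment k x) \<le> norm (1 + indicator (E k) x * \<bar>increment k x\<bar> powr s)"
      by (auto simp: indicator_def)
  qed simp
  have cross: "integrable M (\<lambda>x. signed_powr (s - 1) (T k x) * (indicator (E k) x * increment k x))"
    "(\<integral>x. signed_powr (s - 1) (T k x) * (indicator (E k) x * increment k x) \<partial>M) = 0" for k
  proof -
    define h where "h x = signed_powr (s - 1) (T k x) * indicator (E k) x * c k" for x
    note [measurable] = TF[of k]
    have hF: "h \<in> borel_measurable (F k)" unfolding h_def[abs_def] by measurable
    have eq: "(\<lambda>x. signed_powr (s - 1) (T k x) * (indicator (E k) x * increment k x)) =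
        (\<lambda>x. h x * (Y k x - enn2real (nn_cond_exp M (F k) (\<lambda>x. ennreal (Y k x)) x)))"
      by (simp add: h_def increment_def cond_mean_def mult_ac)
    show int: "integrable M (\<lambda>x. signed_powr (s - 1) (T k x) * (indicator (E k) x * increment k x))"
    proof (rule Bochner_Integration.integrable_bound)
      show "integrable M (\<lambda>x. \<rho> powr (s - 1) * (indicator (E k) x * increment k x))"
        using integrable_increment by simp
      have "\<bar>signed_powr (s - 1) (T k x)\<bar> \<le> \<rho> powr (s - 1)" if "x \<in> E k" for x
      proof -
        have "T k x = partial_sum k x" using that E_anti by (intro T_eq_S) auto
        then have "\<bar>T k x\<bar> powr (s - 1) \<le> \<rho> powr (s - 1)"
          using that s by (intro powr_mono2) (auto simp: E_def less_imp_le)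
        then show ?thesis using abs_signed_powr_le[of "s - 1" "T k x"] by linarith
      qed
      then show "AE x in M. norm (signed_powr (s - 1) (T k x) * (indicator (E k) x * increment k x))
          \<le> norm (\<rho> powr (s - 1) * (indicator (E k) x * increment k x))"
        by (auto simp: indicator_def abs_mult intro!: mult_right_mono)
    qed measurable
    show "(\<integral>x. signed_powr (s - 1) (T k x) * (indicator (E k) x * increment k x) \<partial>M) = 0"
      unfolding eq
    proof (rule sub.integral_mult_diff_cond_exp[OF Y_M hF _ Y_nonneg])
      show "AE x in M. h x \<noteq> 0 \<longrightarrow> nn_cond_exp M (F k) (\<lambda>x. ennreal (Y k x)) x < \<infinity>"
        using cond_mean_finite[of k] by eventually_elim (auto simp: h_def cond_mean_def)
      show "integrable M (\<lambda>x. h x * (Y k x - enn2real (nn_cond_exp M (F k) (\<lambda>x. ennreal (Y k x)) x)))"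
        using int unfolding eq .
    qed unfold_locales
  qed

  have moment: "integrable M (\<lambda>x. \<bar>T n x\<bar> powr s) \<and>
      (\<integral>x. \<bar>T n x\<bar> powr s \<partial>M) \<le> 2 * s * (\<Sum>k<n. \<integral>x. indicator (E k) x * \<bar>increment k x\<bar> powr s \<partial>M)" for n
  proof (induction n)
    case 0
    then show ?case using s by (simp add: T_def)
  next
    case (Suc n)
    define R where "R x = \<bar>T n x\<bar> powr s + s * (signed_powr (s - 1) (T n x) * (indicator (E n) x * increment n x))
        + 2 * s * (indicator (E n) x * \<bar>increment n x\<bar> powr s)" for x
    have le: "\<bar>T (Suc n) x\<bar> powr s \<le> R x" for x
      using abs_add_powr_le[OF s, of "T n x" "indicator (E n) x * increment n x"]
      by (cases "x \<in> E n") (auto simp: T_def R_def)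
    have intR: "integrable M R"
      unfolding R_def[abs_def] using Suc cross(1)[of n] integrable_increment_powr[of n] by simp
    have int: "integrable M (\<lambda>x. \<bar>T (Suc n) x\<bar> powr s)"
      by (rule Bochner_Integration.integrable_bound[OF intR])
        (use le in \<open>auto intro: order_trans[OF _ abs_ge_self]\<close>)
    have "(\<integral>x. \<bar>T (Suc n) x\<bar> powr s \<partial>M) \<le> (\<integral>x. R x \<partial>M)"
      using int intR le by (rule integral_mono)
    also have "\<dots> = (\<integral>x. \<bar>T n x\<bar> powr s \<partial>M) + 2 * s * (\<integral>x. indicator (E n) x * \<bar>increment n x\<bar> powr s \<partial>M)"
      unfolding R_def[abs_def] using Suc cross[of n] integrable_increment_powr[of n] by simp
    finally show ?case using Suc int by (simp add: algebra_simps)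
  qed
  have total: "(\<Sum>k<n. \<integral>x. indicator (E k) x * \<bar>increment k x\<bar> powr s \<partial>M) \<le> L" for n
  proof -
    have "ennreal (\<Sum>k<n. \<integral>x. indicator (E k) x * \<bar>increment k x\<bar> powr s \<partial>M)
        = (\<Sum>k<n. \<integral>\<^sup>+x. ennreal (indicator (E k) x * \<bar>increment k x\<bar> powr s) \<partial>M)"
      using integrable_increment_powr by (simp add: nn_integral_eq_integral)
    also have "\<dots> \<le> (\<Sum>k<n. \<integral>\<^sup>+x. indicator (E k) x * cond_moment k x \<partial>M)"
      by (intro sum_mono increment_le)
    also have "\<dots> = (\<integral>\<^sup>+x. (\<Sum>k<n. indicator (E k) x * cond_moment k x) \<partial>M)"
      by (rule nn_integral_sum[symmetric]) simp
    also have "\<dots> \<le> (\<integral>\<^sup>+x. ennreal L \<partial>M)" by (intro nn_integral_mono sum_le)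
    also have "\<dots> = ennreal L" by (simp add: emeasure_space_1)
    finally show ?thesis using assms(1) by simp
  qed
  have "{x\<in>space M. (\<forall>k. A k x \<le> ennreal L) \<and> (\<exists>j\<le>n. \<rho> \<le> \<bar>partial_sum j x\<bar>)}
      \<subseteq> {x\<in>space M. \<rho> powr s \<le> \<bar>T n x\<bar> powr s}"
  proof safe
    fix x j assume x: "x \<in> space M" "\<forall>k. A k x \<le> ennreal L" and j: "j \<le> n" "\<rho> \<le> \<bar>partial_sum j x\<bar>"
    define i where "i = (LEAST i. \<rho> \<le> \<bar>partial_sum i x\<bar>)"
    have i: "\<rho> \<le> \<bar>partial_sum i x\<bar>" "i \<le> j" "\<And>k. k < i \<Longrightarrow> \<bar>partial_sum k x\<bar> < \<rho>"
      using j(2) by (auto simp: i_def not_le[symmetric] intro: LeastI Least_le dest: not_less_Least)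
    have "x \<in> E k \<longleftrightarrow> k < i" for k
    proof
      show "k < i" if "x \<in> E k" using that i(1) unfolding E_def by (force simp: not_less[symmetric])
      show "x \<in> E k" if "k < i" using that x i(3) unfolding E_def by auto
    qed
    then have "T n x = (\<Sum>k<n. if k < i then increment k x else 0)"
      unfolding T_def by (intro sum.cong) (auto simp: indicator_def)
    also have "\<dots> = (\<Sum>k<i. increment k x)"
      using i(2) j(1) by (intro sum.mono_neutral_cong_right) auto
    finally have "T n x = partial_sum i x" by (simp add: partial_sum_def)
    then show "\<rho> powr s \<le> \<bar>T n x\<bar> powr s" using i(1) assms(2) s by (simp add: powr_mono2)
  qed
  then have "measure M {x\<in>space M. (\<forall>k. A k x \<le> ennreal L) \<and> (\<exists>j\<le>n. \<rho> \<le> \<bar>partial_sum j x\<bar>)}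
      \<le> measure M {x\<in>space M. \<rho> powr s \<le> \<bar>T n x\<bar> powr s}"
    by (rule finite_measure_mono) measurable
  also have "\<dots> \<le> (\<integral>x. \<bar>T n x\<bar> powr s \<partial>M) / \<rho> powr s"
    using moment assms(2) by (intro integral_Markov_inequality_measure[where A = "{}"]) auto
  also have "\<dots> \<le> 2 * s * L / \<rho> powr s"
    using s by (intro divide_right_mono order_trans[OF conjunct2[OF moment]] mult_left_mono total) auto
  finally show ?thesis unfolding A_def .
qed

lemma maximal_inequality:
  assumes "0 \<le> L" "0 < \<rho>"
  shows "measure M {x\<in>space M. (\<forall>k. (\<Sum>j\<le>k. cond_moment j x) \<le> ennreal L) \<and> (\<exists>j. \<rho> \<le> \<bar>partial_sum j x\<bar>)} \<le> 2 * s * L / \<rho> powr s"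
proof -
  define G where "G n = {x\<in>space M. (\<forall>k. (\<Sum>j\<le>k. cond_moment j x) \<le> ennreal L) \<and> (\<exists>j\<le>n. \<rho> \<le> \<bar>partial_sum j x\<bar>)}" for n
  have "(\<lambda>n. measure M (G n)) \<longlonglongrightarrow> measure M (\<Union>n. G n)"
  proof (rule finite_Lim_measure_incseq)
    show "range G \<subseteq> sets M" unfolding G_def by auto
    show "incseq G" by (intro incseq_SucI) (auto simp: G_def intro: le_SucI)
  qed
  then have "measure M (\<Union>n. G n) \<le> 2 * s * L / \<rho> powr s"
    using maximal_inequality_upto[OF assms] by (intro LIMSEQ_le_const2) (auto simp: G_def)
  also have "(\<Union>n. G n) = {x\<in>space M. (\<forall>k. (\<Sum>j\<le>k. cond_moment j x) \<le> ennreal L) \<and> (\<exists>j. \<rho> \<le> \<bar>partial_sum j x\<bar>)}"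
    by (auto simp: G_def)
  finally show ?thesis .
qed

lemma AE_bounded_sums:
  assumes "AE x in M. (\<Sum>n. cond_moment n x) < \<infinity>"
  shows "AE x in M. \<exists>K. \<forall>n. \<bar>partial_sum n x\<bar> \<le> K"
proof -
  define Z where "Z L \<rho> = {x\<in>space M. (\<forall>k. (\<Sum>j\<le>k. cond_moment j x) \<le> ennreal (real L)) \<and> (\<exists>j. real \<rho> \<le> \<bar>partial_sum j x\<bar>)}" for L \<rho> :: nat
  have Z_M [measurable]: "Z L \<rho> \<in> sets M" for L \<rho> unfolding Z_def by measurable
  have "(\<Inter>l. Z L (Suc l)) \<in> null_sets M" for L
  proof -
    have lim: "(\<lambda>l. 2 * s * real L / real (Suc l) powr s) \<longlonglongrightarrow> 0"
      using s by real_asymp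
    have "measure M (\<Inter>l. Z L (Suc l)) \<le> 2 * s * real L / real (Suc l) powr s" for l
    proof -
      have "measure M (\<Inter>l. Z L (Suc l)) \<le> measure M (Z L (Suc l))"
        by (intro finite_measure_mono) auto
      also have "\<dots> \<le> 2 * s * real L / real (Suc l) powr s"
        unfolding Z_def by (rule maximal_inequality) auto
      finally show ?thesis .
    qed
    then have "measure M (\<Inter>l. Z L (Suc l)) \<le> 0"
      using lim by (intro LIMSEQ_le_const) auto
    then have "measure M (\<Inter>l. Z L (Suc l)) = 0"
      by (simp add: measure_le_0_iff)
    then show ?thesis by (auto simp: null_sets_def emeasure_eq_measure)
  qed
  then have "AE x in M. \<forall>L. x \<notin> (\<Inter>l. Z L (Suc l))"
    unfolding AE_all_countable by (intro allI AE_not_in)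
  then show ?thesis
    using assms AE_space
  proof eventually_elim
    case (elim x)
    obtain L :: nat where L: "(\<Sum>n. cond_moment n x) \<le> ennreal (real L)"
      using elim(2) by (metis ennreal_Ex_less_of_nat ennreal_of_nat_eq_real_of_nat infinity_ennreal_def less_imp_le)
    have "(\<Sum>j\<le>k. cond_moment j x) \<le> ennreal (real L)" for k
      by (rule order_trans[OF sum_le_suminf L]) auto
    moreover have "x \<notin> (\<Inter>l. Z L (Suc l))" using elim(1) by blast
    ultimately obtain l where "\<not> (\<exists>j. real (Suc l) \<le> \<bar>partial_sum j x\<bar>)"
      using elim(3) by (auto simp: Z_def)
    then show ?case by (auto simp: not_le intro!: exI[of _ "real (Suc l)"] less_imp_le)
  qed
qed

end

section \<open>Summability from a drift inequality\<close>

text \<open>Dividing by \<open>1 + Z n\<^sub>0\<close>, which is \<open>F n\<^sub>0\<close>-measurable, makes all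
  terms integrable although \<open>Z n\<^sub>0\<close> need not be.\<close>

lemma (in prob_space) AE_summable_of_drift:
  fixes F :: "nat \<Rightarrow> 'a measure" and Z g :: "nat \<Rightarrow> 'a \<Rightarrow> real" and p q :: "nat \<Rightarrow> real"
  assumes subalg: "\<And>n. subalgebra M (F n)"
    and filtration: "\<And>n. sets (F n) \<subseteq> sets (F (Suc n))"
    and ZF: "\<And>n. Z n \<in> borel_measurable (F n)" and Z: "\<And>n x. 0 \<le> Z n x"
    and gM [measurable]: "\<And>n. g n \<in> borel_measurable M" and g: "\<And>n. AE x in M. 0 \<le> g n x"
    and p: "decseq p" "\<And>n. 0 \<le> p n" and q: "\<And>n. 0 \<le> q n" "summable (\<lambda>n. p n * q n)"
    and \<alpha>: "0 < \<alpha>"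
    and drift: "\<And>n. n \<ge> n\<^sub>0 \<Longrightarrow> AE x in M.
      nn_cond_exp M (F n) (\<lambda>x. ennreal (Z (Suc n) x)) x + ennreal (\<alpha> * g n x * Z n x) \<le> ennreal (Z n x + q n)"
  shows "AE x in M. summable (\<lambda>n. p n * g n x * Z n x)"
proof -
  interpret sub: finite_measure_subalgebra M "F n" for n
    by unfold_locales (rule subalg)
  have ZM [measurable]: "Z n \<in> borel_measurable M" for n
    by (rule measurable_from_subalg[OF subalg ZF])
  define h where "h x = 1 / (1 + Z n\<^sub>0 x)" for x
  have h: "0 < h x" "h x \<le> 1" "h x * Z n\<^sub>0 x \<le> 1" for x
    using Z[of n\<^sub>0 x] by (simp_all add: h_def field_simps)
  have hF: "h \<in> borel_measurable (F n)" if "n \<ge> n\<^sub>0" for n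
  proof -
    have [measurable]: "Z n\<^sub>0 \<in> borel_measurable (F n)"
      using measurable_filtration_mono[where M = M and F = F, OF subalg filtration ZF that] .
    show ?thesis unfolding h_def[abs_def] by measurable
  qed
  have hM [measurable]: "h \<in> borel_measurable M"
    by (rule measurable_from_subalg[OF subalg hF[OF order_refl]])
  define a where "a n = (\<integral>\<^sup>+x. ennreal (h x * p n) * ennreal (Z n x) \<partial>M)" for n
  define b where "b n = (\<integral>\<^sup>+x. ennreal (h x * (p n * g n x * Z n x)) \<partial>M)" for n
  have step: "a (Suc n) + ennreal \<alpha> * b n \<le> a n + ennreal (p n * q n)" if n: "n \<ge> n\<^sub>0" for n
  proof -
    let ?e = "nn_cond_exp M (F n) (\<lambda>x. ennreal (Z (Suc n) x))"
    note [measurable] = hF[OF n]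
    have "a (Suc n) \<le> (\<integral>\<^sup>+x. ennreal (h x * p n) * ennreal (Z (Suc n) x) \<partial>M)"
      unfolding a_def using decseqD[OF p(1), of n "Suc n"] h(1)
      by (intro nn_integral_mono mult_right_mono ennreal_leI mult_left_mono) (auto simp: less_imp_le)
    also have "\<dots> = (\<integral>\<^sup>+x. ennreal (h x * p n) * ?e x \<partial>M)"
      by (rule sub.nn_cond_exp_intg[symmetric]) measurable
    finally have "a (Suc n) + ennreal \<alpha> * b n
        \<le> (\<integral>\<^sup>+x. ennreal (h x * p n) * ?e x \<partial>M) + (\<integral>\<^sup>+x. ennreal \<alpha> * ennreal (h x * (p n * g n x * Z n x)) \<partial>M)"
      by (simp add: b_def nn_integral_cmult add_right_mono)
    also have "\<dots> = (\<integral>\<^sup>+x. ennreal (h x * p n) * ?e x + ennreal \<alpha> * ennreal (h x * (p n * g n x * Z n x)) \<partial>M)"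
      by (rule nn_integral_add[symmetric]) measurable
    also have "\<dots> \<le> (\<integral>\<^sup>+x. ennreal (h x * p n) * ennreal (Z n x) + ennreal (p n * q n) \<partial>M)"
    proof (rule nn_integral_mono_AE)
      show "AE x in M. ennreal (h x * p n) * ?e x + ennreal \<alpha> * ennreal (h x * (p n * g n x * Z n x))
          \<le> ennreal (h x * p n) * ennreal (Z n x) + ennreal (p n * q n)"
        using drift[OF n] g[of n]
      proof eventually_elim
        case (elim x)
        have hp: "0 \<le> h x * p n" using h(1)[of x] p(2)[of n] by simp
        have "ennreal \<alpha> * ennreal (h x * (p n * g n x * Z n x)) = ennreal (h x * p n) * ennreal (\<alpha> * g n x * Z n x)"
          using hp \<alpha> elim(2) Z[of n x] h(1)[of x] p(2)[of n]
          by (simp add: ennreal_mult[symmetric] mult_ac)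
        then have "ennreal (h x * p n) * ?e x + ennreal \<alpha> * ennreal (h x * (p n * g n x * Z n x))
            = ennreal (h x * p n) * (?e x + ennreal (\<alpha> * g n x * Z n x))"
          by (simp add: distrib_left)
        also have "\<dots> \<le> ennreal (h x * p n) * ennreal (Z n x + q n)"
          using elim(1) by (rule mult_left_mono) simp
        also have "\<dots> = ennreal (h x * p n) * ennreal (Z n x) + ennreal (h x * p n * q n)"
          using hp Z[of n x] q(1)[of n] by (simp add: ennreal_mult distrib_left)
        also have "\<dots> \<le> ennreal (h x * p n) * ennreal (Z n x) + ennreal (p n * q n)"
          using h(2)[of x] p(2)[of n] q(1)[of n]
          by (intro add_left_mono ennreal_leI mult_right_mono mult_left_le_one_le) (auto simp: h(1) less_imp_le)
        finally show ?case .
      qed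
    qed
    also have "\<dots> = a n + ennreal (p n * q n)"
      by (simp add: a_def nn_integral_add emeasure_space_1)
    finally show ?thesis .
  qed
  define C where "C = p n\<^sub>0 + (\<Sum>n. p (n + n\<^sub>0) * q (n + n\<^sub>0))"
  have part: "ennreal \<alpha> * (\<Sum>k<m. b (k + n\<^sub>0)) + a (m + n\<^sub>0)
      \<le> ennreal (p n\<^sub>0 + (\<Sum>k<m. p (k + n\<^sub>0) * q (k + n\<^sub>0)))" for m
  proof (induction m)
    case 0
    have "a n\<^sub>0 \<le> (\<integral>\<^sup>+x. ennreal (p n\<^sub>0) \<partial>M)"
      unfolding a_def
    proof (rule nn_integral_mono)
      fix x
      have "h x * p n\<^sub>0 * Z n\<^sub>0 x \<le> p n\<^sub>0"
        using mult_right_mono[OF h(3)[of x] p(2)[of n\<^sub>0]] by (simp add: mult_ac)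
      then show "ennreal (h x * p n\<^sub>0) * ennreal (Z n\<^sub>0 x) \<le> ennreal (p n\<^sub>0)"
        using h(1)[of x] p(2)[of n\<^sub>0] Z[of n\<^sub>0 x] by (simp add: ennreal_mult[symmetric] ennreal_leI)
    qed
    then show ?case by (simp add: emeasure_space_1)
  next
    case (Suc m)
    have "ennreal \<alpha> * (\<Sum>k<Suc m. b (k + n\<^sub>0)) + a (Suc m + n\<^sub>0)
        = ennreal \<alpha> * (\<Sum>k<m. b (k + n\<^sub>0)) + (a (Suc (m + n\<^sub>0)) + ennreal \<alpha> * b (m + n\<^sub>0))"
      by (simp add: distrib_left add_ac)
    also have "\<dots> \<le> ennreal \<alpha> * (\<Sum>k<m. b (k + n\<^sub>0)) + (a (m + n\<^sub>0) + ennreal (p (m + n\<^sub>0) * q (m + n\<^sub>0)))"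
      by (intro add_left_mono step) simp
    also have "\<dots> \<le> ennreal (p n\<^sub>0 + (\<Sum>k<m. p (k + n\<^sub>0) * q (k + n\<^sub>0))) + ennreal (p (m + n\<^sub>0) * q (m + n\<^sub>0))"
      using Suc by (simp add: add.assoc[symmetric] add_right_mono)
    also have "\<dots> = ennreal (p n\<^sub>0 + (\<Sum>k<Suc m. p (k + n\<^sub>0) * q (k + n\<^sub>0)))"
      using p(2) q(1) by (subst ennreal_plus[symmetric]) (auto intro!: add_nonneg_nonneg sum_nonneg simp: add.assoc)
    finally show ?case .
  qed
  have "(\<Sum>k<m. b (k + n\<^sub>0)) \<le> ennreal (C / \<alpha>)" for m
  proof -
    have "ennreal \<alpha> * (\<Sum>k<m. b (k + n\<^sub>0)) \<le> ennreal (p n\<^sub>0 + (\<Sum>k<m. p (k + n\<^sub>0) * q (k + n\<^sub>0)))"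
      using part[of m] by (rule order_trans[rotated]) simp
    also have "\<dots> \<le> ennreal C"
      unfolding C_def using q p(2)
      by (intro ennreal_leI add_left_mono sum_le_suminf) (auto simp: summable_iff_shift[of "\<lambda>n. p n * q n"])
    finally have "ennreal (1 / \<alpha>) * (ennreal \<alpha> * (\<Sum>k<m. b (k + n\<^sub>0))) \<le> ennreal (1 / \<alpha>) * ennreal C"
      by (rule mult_left_mono) simp
    then show ?thesis
      using \<alpha> by (simp add: mult.assoc[symmetric] ennreal_mult'[symmetric])
  qed
  then have "(\<Sum>k. b (k + n\<^sub>0)) \<le> ennreal (C / \<alpha>)"
    by (intro suminf_le_const) auto
  then have "(\<integral>\<^sup>+x. (\<Sum>k. ennreal (h x * (p (k + n\<^sub>0) * g (k + n\<^sub>0) x * Z (k + n\<^sub>0) x))) \<partial>M) \<noteq> \<infinity>"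
    by (subst nn_integral_suminf) (auto simp: b_def top_unique)
  then have "AE x in M. (\<Sum>k. ennreal (h x * (p (k + n\<^sub>0) * g (k + n\<^sub>0) x * Z (k + n\<^sub>0) x))) \<noteq> \<infinity>"
    by (intro nn_integral_noteq_infinite) auto
  moreover have "AE x in M. \<forall>n. 0 \<le> g n x" using g by (simp add: AE_all_countable)
  ultimately show ?thesis
  proof eventually_elim
    case (elim x)
    have "summable (\<lambda>k. h x * (p (k + n\<^sub>0) * g (k + n\<^sub>0) x * Z (k + n\<^sub>0) x))"
      using elim h(1)[of x] p(2) Z by (intro summable_suminf_not_top) (auto simp: less_imp_le)
    then have "summable (\<lambda>k. p (k + n\<^sub>0) * g (k + n\<^sub>0) x * Z (k + n\<^sub>0) x)"
      using h(1)[of x] by (simp add: summable_cmult_iff)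
    then show ?case by (simp only: summable_iff_shift[of "\<lambda>n. p n * g n x * Z n x"])
  qed
qed

section \<open>The Euler scheme\<close>

lemma continuous_on_matrix_vector_mult:
  fixes A :: "'x::topological_space \<Rightarrow> real^'m^'d" and v :: "'x \<Rightarrow> real^'m"
  assumes "continuous_on S A" "continuous_on S v"
  shows "continuous_on S (\<lambda>x. A x *v v x)"
  unfolding matrix_vector_mult_def using assms by (intro continuous_intros)

lemma borel_measurable_matrix_vector_mult:
  fixes A :: "'x \<Rightarrow> real^'m^'d" and v :: "'x \<Rightarrow> real^'m"
  assumes "A \<in> borel_measurable N" "v \<in> borel_measurable N"
  shows "(\<lambda>x. A x *v v x) \<in> borel_measurable N"
proof (rule borel_measurable_continuous_Pair[OF assms])
  show "continuous_on UNIV (\<lambda>x. fst x *v snd x :: real^'d)"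
    by (intro continuous_on_matrix_vector_mult continuous_intros)
qed

lemma sets_noise_filtration:
  "sets (noise_filtration M U n) =
    sigma_sets (space M) {U i -` A \<inter> space M | i A. i \<in> {1..n} \<and> A \<in> sets borel}"
  unfolding noise_filtration_def by (rule sets_measure_of) auto

lemma space_noise_filtration: "space (noise_filtration M U n) = space M"
  unfolding noise_filtration_def by (rule space_measure_of) auto

lemma noise_filtration_mono: "sets (noise_filtration M U n) \<subseteq> sets (noise_filtration M U (Suc n))"
  unfolding sets_noise_filtration by (rule sigma_sets_mono') fastforce

lemma subalgebra_noise_filtration:
  fixes U :: "nat \<Rightarrow> 'a \<Rightarrow> real^'m"
  assumes "\<And>i. i \<ge> 1 \<Longrightarrow> U i \<in> borel_measurable M"
  shows "subalgebra M (noise_filtration M U n)"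
  unfolding subalgebra_def space_noise_filtration sets_noise_filtration
  using assms by (auto intro!: sets.sigma_sets_subset measurable_sets)

lemma measurable_noise_filtration:
  fixes U :: "nat \<Rightarrow> 'a \<Rightarrow> real^'m"
  assumes "1 \<le> i" "i \<le> n"
  shows "U i \<in> borel_measurable (noise_filtration M U n)"
proof (rule measurableI)
  show "U i -` A \<inter> space (noise_filtration M U n) \<in> sets (noise_filtration M U n)" if "A \<in> sets borel" for A
    unfolding sets_noise_filtration space_noise_filtration
    using that assms by (intro sigma_sets.Basic) auto
qed simp

lemma measurable_euler_scheme:
  fixes U :: "nat \<Rightarrow> 'a \<Rightarrow> real^'m" and \<sigma> :: "real^'d \<Rightarrow> real^'m^'d"
  assumes U: "\<And>i. i \<ge> 1 \<Longrightarrow> U i \<in> borel_measurable M"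
    and [measurable]: "b \<in> borel_measurable borel" "\<sigma> \<in> borel_measurable borel"
    and g: "\<And>n. g (Suc n) \<in> borel_measurable (noise_filtration M U n)"
  shows "euler_scheme b \<sigma> x\<^sub>0 g U n \<in> borel_measurable (noise_filtration M U n)"
proof (induction n)
  case 0
  have "euler_scheme b \<sigma> x\<^sub>0 g U 0 = (\<lambda>_. x\<^sub>0)" by (rule ext) simp
  then show ?case by simp
next
  case (Suc n)
  let ?F = "noise_filtration M U"
  have subalg: "subalgebra M (?F n)" for n by (rule subalgebra_noise_filtration[OF U])
  note mono = measurable_filtration_mono[where M = M and F = ?F and i = n and j = "Suc n",
      OF subalg noise_filtration_mono _ le_SucI[OF order_refl]]
  have [measurable]: "euler_scheme b \<sigma> x\<^sub>0 g U n \<in> borel_measurable (?F (Suc n))"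
    by (rule mono[OF Suc])
  have [measurable]: "g (Suc n) \<in> borel_measurable (?F (Suc n))" by (rule mono[OF g])
  have [measurable]: "U (Suc n) \<in> borel_measurable (?F (Suc n))"
    by (rule measurable_noise_filtration) auto
  have [measurable]: "(\<lambda>\<omega>. \<sigma> (euler_scheme b \<sigma> x\<^sub>0 g U n \<omega>) *v U (Suc n) \<omega>) \<in> borel_measurable (?F (Suc n))"
    by (rule borel_measurable_matrix_vector_mult) measurable
  have "euler_scheme b \<sigma> x\<^sub>0 g U (Suc n) = (\<lambda>\<omega>. euler_scheme b \<sigma> x\<^sub>0 g U n \<omega>
      + g (Suc n) \<omega> *\<^sub>R b (euler_scheme b \<sigma> x\<^sub>0 g U n \<omega>)
      + sqrt (g (Suc n) \<omega>) *\<^sub>R (\<sigma> (euler_scheme b \<sigma> x\<^sub>0 g U n \<omega>) *v U (Suc n) \<omega>))"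
    by (rule ext) simp
  also have "\<dots> \<in> borel_measurable (?F (Suc n))" by measurable
  finally show ?case .
qed

lemma nn_integral_weighted_empirical_measure:
  assumes [measurable]: "W \<in> borel_measurable borel"
    and "\<And>x. 0 \<le> W x" "\<And>k. k \<ge> 1 \<Longrightarrow> 0 \<le> \<eta> k"
  shows "(\<integral>\<^sup>+x. ennreal (W x) \<partial>(weighted_empirical_measure \<eta> X n \<omega>))
    = ennreal ((\<Sum>k<n. \<eta> (Suc k) * W (X k \<omega>)) / cumulative_weight \<eta> n)"
proof -
  let ?H = "cumulative_weight \<eta> n"
  have H: "0 \<le> ?H" unfolding cumulative_weight_def using assms(3) by (intro sum_nonneg) auto
  have "(\<integral>\<^sup>+x. ennreal (W x) \<partial>(weighted_empirical_measure \<eta> X n \<omega>))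
      = (\<integral>\<^sup>+k. ennreal (W (X (k - 1) \<omega>)) \<partial>point_measure {1..n} (\<lambda>k. ennreal (\<eta> k / ?H)))"
    unfolding weighted_empirical_measure_def
  proof (rule nn_integral_distr)
    show "(\<lambda>k. X (k - 1) \<omega>) \<in> borel_measurable (point_measure {1..n} (\<lambda>k. ennreal (\<eta> k / ?H)))"
      by (simp add: measurable_def space_point_measure sets_point_measure)
  qed simp
  also have "\<dots> = (\<Sum>k=1..n. ennreal (\<eta> k / ?H) * ennreal (W (X (k - 1) \<omega>)))"
    by (rule nn_integral_point_measure_finite) simp
  also have "\<dots> = (\<Sum>k=1..n. ennreal (\<eta> k * W (X (k - 1) \<omega>) / ?H))"
    using assms H by (intro sum.cong) (auto simp: ennreal_mult[symmetric] zero_le_divide_iff)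
  also have "\<dots> = ennreal (\<Sum>k=1..n. \<eta> k * W (X (k - 1) \<omega>) / ?H)"
    using assms H by (intro sum_ennreal) auto
  also have "(\<Sum>k=1..n. \<eta> k * W (X (k - 1) \<omega>) / ?H) = (\<Sum>k<n. \<eta> (Suc k) * W (X k \<omega>)) / ?H"
    unfolding sum_divide_distrib
    by (rule sum.reindex_bij_witness[of _ Suc "\<lambda>k. k - 1"]) auto
  finally show ?thesis .
qed

lemma ereal_drift_imp_ennreal_drift:
  fixes m :: ennreal and w g \<alpha> \<beta> :: real
  assumes "(enn2ereal m - ereal w) / ereal g \<le> ereal (- \<alpha> * w + \<beta>)"
    and "0 < g" "0 \<le> w" "0 \<le> \<alpha>"
  shows "m < \<infinity>" "enn2real m \<le> w + g * (\<beta> - \<alpha> * w)"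
    "\<And>q. g \<le> q \<Longrightarrow> 0 \<le> \<beta> \<Longrightarrow> m + ennreal (\<alpha> * g * w) \<le> ennreal (w + \<beta> * q)"
proof -
  obtain r where r: "0 \<le> r" "m = ennreal r"
  proof (cases m)
    case top
    then show ?thesis using assms(1,2) by simp
  qed (use that in auto)
  have "(r - w) / g \<le> - \<alpha> * w + \<beta>"
    using assms(1,2) r by (simp add: enn2ereal_ennreal)
  then have le: "r \<le> w + g * (\<beta> - \<alpha> * w)"
    using assms(2) by (simp add: field_simps)
  show "m < \<infinity>" "enn2real m \<le> w + g * (\<beta> - \<alpha> * w)" using r le by auto
  show "m + ennreal (\<alpha> * g * w) \<le> ennreal (w + \<beta> * q)" if "g \<le> q" "0 \<le> \<beta>" for q
  proof -
    have "r + \<alpha> * g * w \<le> w + \<beta> * q"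
      using le mult_left_mono[OF that] by (simp add: algebra_simps)
    then show ?thesis
      using r assms by (simp add: ennreal_plus[symmetric] ennreal_leI del: ennreal_plus)
  qed
qed

theorem theorem7:
  fixes M :: "'a measure"
    and U :: "nat \<Rightarrow> 'a \<Rightarrow> real^'m"
    and b :: "real^'d \<Rightarrow> real^'d"
    and \<sigma> :: "real^'d \<Rightarrow> real^'m^'d"
    and \<gamma> \<eta> :: "nat \<Rightarrow> real"
    and \<xi> :: "nat \<Rightarrow> 'a \<Rightarrow> real"
    and x\<^sub>0 :: "real^'d"
    and W :: "real^'d \<Rightarrow> real"
    and n\<^sub>1 :: "'a \<Rightarrow> enat"
    and n\<^sub>0 :: nat
    and \<alpha> \<beta> s :: real
  defines "F \<equiv> noise_filtration M U"
    and "\<gamma>' \<equiv> truncated_step \<gamma> \<xi>"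
    and "X \<equiv> euler_scheme b \<sigma> x\<^sub>0 (truncated_step \<gamma> \<xi>) U"
    and "H \<equiv> cumulative_weight \<eta>"
  assumes "prob_space M"
    and "iid_subgaussian_noise M U"
    and "local_lipschitz (UNIV :: real set) UNIV (\<lambda>_. b)"
    and "local_lipschitz (UNIV :: real set) UNIV (\<lambda>_. \<sigma>)"
    and "\<forall>n. \<gamma> n > 0" and "decseq \<gamma>" and "\<gamma> \<longlonglongrightarrow> 0" and "\<not> summable \<gamma>"
    and "\<forall>n. \<xi> n \<in> borel_measurable (F n)"
    and "\<forall>n. AE \<omega> in M. \<xi> n \<omega> > 0"
    and "lyapunov_condition b \<sigma>"
    and "\<eta> 0 = 0" and "\<forall>n\<ge>1. \<eta> n > 0" and "\<not> summable \<eta>"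
    and "step_weight_SW \<gamma> \<eta>"
    and "n\<^sub>1 \<in> measurable M (count_space UNIV)"
    and "AE \<omega> in M. n\<^sub>1 \<omega> < \<infinity>"
    and "AE \<omega> in M. \<forall>n. enat n \<ge> n\<^sub>1 \<omega> \<longrightarrow> \<gamma>' n \<omega> = \<gamma> n"
    and "W \<in> borel_measurable borel" and "\<forall>x. W x > 0"
    and "\<alpha> > 0" and "\<beta> > 0"
    and "\<forall>n\<ge>n\<^sub>0. AE \<omega> in M.
           (enn2ereal (nn_cond_exp M (F n) (\<lambda>\<omega>. ennreal (W (X (Suc n) \<omega>))) \<omega>) - ereal (W (X n \<omega>)))
             / ereal (\<gamma>' (Suc n) \<omega>)
           \<le> ereal (- \<alpha> * W (X n \<omega>) + \<beta>)"
    and "1 < s" and "s \<le> 2"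
    and "AE \<omega> in M.
           (\<Sum>n. ennreal ((\<eta> (Suc n) / (H (Suc n) * \<gamma> (Suc n))) powr s)
                 * cond_central_abs_moment M (F n) (\<lambda>\<omega>. W (X (Suc n) \<omega>)) s \<omega>) < \<infinity>"
  shows "AE \<omega> in M.
           (SUP n\<in>{1..}. \<integral>\<^sup>+x. ennreal (W x) \<partial>(weighted_empirical_measure \<eta> X n \<omega>)) < \<infinity>"
proof -
  interpret prob_space M by fact
  note noise = \<open>iid_subgaussian_noise M U\<close>
  note \<gamma>_pos = \<open>\<forall>n. \<gamma> n > 0\<close>[rule_format]
  note \<eta>_pos = \<open>\<forall>n\<ge>1. \<eta> n > 0\<close>[rule_format]
  note W_pos = \<open>\<forall>x. W x > 0\<close>[rule_format]
  note [measurable] = \<open>W \<in> borel_measurable borel\<close>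
  have W_nonneg: "0 \<le> W x" for x using W_pos[of x] by simp
  have U: "U i \<in> borel_measurable M" if "i \<ge> 1" for i
    using noise that unfolding iid_subgaussian_noise_def indep_vars_def2 by auto
  have subalg: "subalgebra M (F n)" for n
    unfolding F_def by (rule subalgebra_noise_filtration[OF U])
  have filtration: "sets (F n) \<subseteq> sets (F (Suc n))" for n
    unfolding F_def by (rule noise_filtration_mono)
  have g_F: "\<gamma>' (Suc n) \<in> borel_measurable (F n)" for n
  proof -
    have [measurable]: "\<xi> n \<in> borel_measurable (F n)" using \<open>\<forall>n. \<xi> n \<in> borel_measurable (F n)\<close> by blast
    show ?thesis unfolding \<gamma>'_def truncated_step_def[abs_def] by simp
  qed
  have g_M: "\<gamma>' (Suc n) \<in> borel_measurable M" for n
    by (rule measurable_from_subalg[OF subalg g_F])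
  have g_pos: "AE \<omega> in M. 0 < \<gamma>' (Suc n) \<omega>" for n
    using \<open>\<forall>n. AE \<omega> in M. \<xi> n \<omega> > 0\<close>[rule_format, of n]
    by eventually_elim (simp add: \<gamma>'_def truncated_step_def \<gamma>_pos)
  have g_le: "\<gamma>' (Suc n) \<omega> \<le> \<gamma> (Suc n)" for n \<omega>
    by (simp add: \<gamma>'_def truncated_step_def)
  have X_F: "X n \<in> borel_measurable (F n)" for n
    unfolding X_def F_def
  proof (rule measurable_euler_scheme[OF U])
    show "b \<in> borel_measurable borel" "\<sigma> \<in> borel_measurable borel"
      using local_lipschitz_continuous_on[OF \<open>local_lipschitz UNIV UNIV (\<lambda>_. b)\<close>]
        local_lipschitz_continuous_on[OF \<open>local_lipschitz UNIV UNIV (\<lambda>_. \<sigma>)\<close>]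
      by (auto intro: borel_measurable_continuous_onI)
    show "truncated_step \<gamma> \<xi> (Suc n) \<in> borel_measurable (noise_filtration M U n)" for n
      using g_F by (simp add: \<gamma>'_def F_def)
  qed
  define Z where "Z n \<omega> = W (X n \<omega>)" for n \<omega>
  have Z_F: "Z n \<in> borel_measurable (F n)" for n
    unfolding Z_def[abs_def] using X_F[of n] by measurable
  have Z_nonneg: "0 \<le> Z n \<omega>" for n \<omega> by (simp add: Z_def W_nonneg)

  have H_pos: "0 < H (Suc n)" for n
    unfolding H_def cumulative_weight_def by (intro sum_pos \<eta>_pos) auto
  define p where "p n = 1 / (\<gamma> (Suc n) * H (Suc n)) * max (ratio_increment \<gamma> \<eta> (Suc n)) 0" for n
  have p_nonneg: "0 \<le> p n" for n
    using \<gamma>_pos[of "Suc n"] H_pos[of n] by (simp add: p_def)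
  note SW = \<open>step_weight_SW \<gamma> \<eta>\<close>[unfolded step_weight_SW_def Let_def, folded H_def]
  have p_dec: "decseq p"
  proof (rule decseq_SucI)
    have "antimono_on {1..} (\<lambda>n. 1 / (\<gamma> n * H n) * max (ratio_increment \<gamma> \<eta> n) 0)"
      using SW by blast
    then show "p (Suc n) \<le> p n" for n
      unfolding p_def by (rule monotone_onD) auto
  qed
  have p_summable: "summable (\<lambda>n. p n * (\<beta> * \<gamma> (Suc n)))"
  proof -
    have "summable (\<lambda>n. \<beta> * (1 / H (Suc n) * max (ratio_increment \<gamma> \<eta> (Suc n)) 0))"
      using SW by (intro summable_mult) blast
    moreover have "\<beta> * (1 / H (Suc n) * max (ratio_increment \<gamma> \<eta> (Suc n)) 0) = p n * (\<beta> * \<gamma> (Suc n))" for n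
      using \<gamma>_pos[of "Suc n"] by (simp add: p_def)
    ultimately show ?thesis by simp
  qed
  define c where "c n = \<eta> (Suc n) / (H (Suc n) * \<gamma> (Suc n))" for n
  interpret centred_sums M F "\<lambda>n. Z (Suc n)" c s
  proof
    show "0 < c n" for n using \<gamma>_pos[of "Suc n"] \<eta>_pos[of "Suc n"] H_pos[of n] by (simp add: c_def)
  qed (use subalg filtration Z_F Z_nonneg \<open>1 < s\<close> \<open>s \<le> 2\<close> in auto)

  have drift: "AE \<omega> in M. (enn2ereal (cond_mean n \<omega>) - ereal (Z n \<omega>)) / ereal (\<gamma>' (Suc n) \<omega>)
      \<le> ereal (- \<alpha> * Z n \<omega> + \<beta>)" if "n \<ge> n\<^sub>0" for n
    using \<open>\<forall>n\<ge>n\<^sub>0. AE \<omega> in M. _ n \<omega>\<close> that by (simp add: cond_mean_def Z_def)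
  have "AE \<omega> in M. summable (\<lambda>n. p n * \<gamma>' (Suc n) \<omega> * Z n \<omega>)"
  proof (rule AE_summable_of_drift[where F = F and Z = Z and g = "\<lambda>n. \<gamma>' (Suc n)" and p = p
        and q = "\<lambda>n. \<beta> * \<gamma> (Suc n)", OF subalg filtration Z_F Z_nonneg g_M _ p_dec p_nonneg _ p_summable \<open>\<alpha> > 0\<close>])
    show "AE \<omega> in M. 0 \<le> \<gamma>' (Suc n) \<omega>" for n
      using g_pos[of n] by eventually_elim simp
    show "0 \<le> \<beta> * \<gamma> (Suc n)" for n using \<open>\<beta> > 0\<close> \<gamma>_pos[of "Suc n"] by simp
    fix n assume "n \<ge> n\<^sub>0"
    show "AE \<omega> in M. nn_cond_exp M (F n) (\<lambda>\<omega>. ennreal (Z (Suc n) \<omega>)) \<omega>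
        + ennreal (\<alpha> * \<gamma>' (Suc n) \<omega> * Z n \<omega>) \<le> ennreal (Z n \<omega> + \<beta> * \<gamma> (Suc n))"
      using drift[OF \<open>n \<ge> n\<^sub>0\<close>] g_pos[of n]
    proof eventually_elim
      case (elim \<omega>)
      show ?case
        using ereal_drift_imp_ennreal_drift(3)[OF elim Z_nonneg _ g_le] \<open>\<alpha> > 0\<close> \<open>\<beta> > 0\<close>
        by (simp add: cond_mean_def)
    qed
  qed
  moreover have "AE \<omega> in M. \<exists>K. \<forall>n. \<bar>partial_sum n \<omega>\<bar> \<le> K"
  proof (rule AE_bounded_sums)
    show "AE \<omega> in M. (\<Sum>n. cond_moment n \<omega>) < \<infinity>"
    proof -
      have "(\<lambda>\<omega>. W (X (Suc n) \<omega>)) = Z (Suc n)" for n by (simp add: Z_def fun_eq_iff)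
      then show ?thesis
        using \<open>AE \<omega> in M. (\<Sum>n. _ n * _ n \<omega>) < \<infinity>\<close> by (simp add: cond_moment_def c_def)
    qed
  qed
  moreover have "AE \<omega> in M. \<forall>n. n \<ge> n\<^sub>0 \<longrightarrow> (enn2ereal (cond_mean n \<omega>) - ereal (Z n \<omega>)) / ereal (\<gamma>' (Suc n) \<omega>)
      \<le> ereal (- \<alpha> * Z n \<omega> + \<beta>)"
    using drift by (simp add: AE_all_countable)
  moreover have "AE \<omega> in M. \<forall>n. 0 < \<gamma>' (Suc n) \<omega>"
    using g_pos by (simp add: AE_all_countable)
  ultimately show ?thesis
    using \<open>AE \<omega> in M. n\<^sub>1 \<omega> < \<infinity>\<close> \<open>AE \<omega> in M. \<forall>n. enat n \<ge> n\<^sub>1 \<omega> \<longrightarrow> \<gamma>' n \<omega> = \<gamma> n\<close>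
  proof eventually_elim
    case (elim \<omega>)
    obtain K where K: "\<bar>partial_sum n \<omega>\<bar> \<le> K" for n using elim(2) by blast
    obtain n1 where n1: "n\<^sub>1 \<omega> = enat n1" using elim(5) by (cases "n\<^sub>1 \<omega>") auto
    have g_eq: "\<gamma>' n \<omega> = \<gamma> n" if "n \<ge> n1" for n using elim(6) n1 that by simp
    have "\<exists>C. \<forall>n\<ge>1. (\<Sum>k<n. \<eta> (Suc k) * Z k \<omega>) \<le> C * (\<Sum>k=1..n. \<eta> k)"
    proof (rule weighted_average_bounded[where N = "max n\<^sub>0 n1"])
      show "enn2real (cond_mean k \<omega>) \<le> Z k \<omega> + \<gamma> (Suc k) * (\<beta> - \<alpha> * Z k \<omega>)" if "max n\<^sub>0 n1 \<le> k" for k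
        using ereal_drift_imp_ennreal_drift(2)[OF elim(3)[rule_format] elim(4)[rule_format] Z_nonneg, of k]
          that \<open>\<alpha> > 0\<close> g_eq[of "Suc k"] by simp
      show "\<bar>\<Sum>k<n. \<eta> (Suc k) / ((\<Sum>k=1..Suc k. \<eta> k) * \<gamma> (Suc k)) * (Z (Suc k) \<omega> - enn2real (cond_mean k \<omega>))\<bar> \<le> K" for n
        using K[of n] by (simp add: partial_sum_def increment_def c_def H_def cumulative_weight_def)
      have "summable (\<lambda>k. max (ratio_increment \<gamma> \<eta> (Suc k)) 0 / H (Suc k) * Z k \<omega>)"
      proof (subst summable_cong)
        show "eventually (\<lambda>k. max (ratio_increment \<gamma> \<eta> (Suc k)) 0 / H (Suc k) * Z k \<omega>
            = p k * \<gamma>' (Suc k) \<omega> * Z k \<omega>) sequentially"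
          using eventually_ge_at_top[of n1]
        proof eventually_elim
          case (elim k)
          then show ?case using g_eq[of "Suc k"] \<gamma>_pos[of "Suc k"] by (simp add: p_def)
        qed
      qed (use elim(1) in simp)
      then show "summable (\<lambda>k. max (\<eta> (Suc k) / \<gamma> (Suc k) - \<eta> (Suc k - 1) / \<gamma> (Suc k - 1)) 0
          / (\<Sum>k=1..Suc k. \<eta> k) * Z k \<omega>)"
        by (simp add: ratio_increment_def H_def cumulative_weight_def)
    qed (use \<gamma>_pos \<eta>_pos \<open>\<eta> 0 = 0\<close> Z_nonneg \<open>\<alpha> > 0\<close> in auto)
    then obtain C where C: "(\<Sum>k<n. \<eta> (Suc k) * Z k \<omega>) \<le> C * H n" if "n \<ge> 1" for n
      by (auto simp: H_def cumulative_weight_def)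
    have "(SUP n\<in>{1..}. \<integral>\<^sup>+x. ennreal (W x) \<partial>(weighted_empirical_measure \<eta> X n \<omega>)) \<le> ennreal C"
    proof (rule SUP_least)
      fix n :: nat assume "n \<in> {1..}"
      then have n: "n \<ge> 1" and "0 < H n" using H_pos[of "n - 1"] by auto
      then have "(\<Sum>k<n. \<eta> (Suc k) * W (X k \<omega>)) / cumulative_weight \<eta> n \<le> C"
        using C[OF n] by (simp add: Z_def H_def pos_divide_le_eq)
      then show "(\<integral>\<^sup>+x. ennreal (W x) \<partial>(weighted_empirical_measure \<eta> X n \<omega>)) \<le> ennreal C"
        using \<eta>_pos W_nonneg
        by (subst nn_integral_weighted_empirical_measure) (auto intro: ennreal_leI less_imp_le)
    qed
    also have "\<dots> < \<infinity>" by simp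
    finally show ?case .
  qed
qed

end
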